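(* Let $\{\Phi_n\}_{n=1}^\infty$, $\Phi_n=\{\phi_{n,j}\}_{j=1}^{N_n}$, be a self-similar MIFS on a compact set $X\subset\mathbb{R}^d$, where $\phi_{n,j}(x)=r_{n,j}O_{n,j}(x+\alpha_{n,j})$ with $r_{n,j}\in(0,1)$, $O_{n,j}$ orthogonal matrices and $\alpha_{n,j}\in\mathbb{R}^d$. Assume that the MIFS satisfies the Moran-type open set condition (MOSC) and that $r_0:=\inf\{r_{n,j}:1\le j\le N_n,\ n\ge1\}>0$. For each $k\ge1$ let $s_k$ be the unique solution $s$ of $\prod_{i=1}^k\sum_{j=1}^{N_i}r_{i,j}^s=1$. Then: (i) $\dim_{\rm H}(K_1)=\liminf\limits_{k\to+\infty}s_k$. (ii) Let $s=\dim_{\rm H}(K_1)$ and $L=\liminf\limits_{n\to\infty}\prod_{i=1}^n\sum_{j=1}^{N_i}r_{i,j}^s$. Then $\mathcal{H}^s(K_1)=+\infty$ if $L=+\infty$; $\mathcal{H}^s(K_1)=0$ if $L=0$; and $0<\mathcal{H}^s(K_1)<+\infty$ if $0<L<+\infty$. (iii) If $r_{n,j}=r_n$ for all $n\ge1$ and $1\le j\le N_n$, then $\dim_{\rm H}(K_1)=\underline{\dim}_{\rm B}(K_1)$.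
   Context: Self-similar MIFS. $X\subset\mathbb{R}^d$ is a nonempty compact set; for each $n\ge1$, $\Phi_n=\{\phi_{n,j}\}_{j=1}^{N_n}$ with $2\le N_n<+\infty$ consists of contracting similarities $\phi_{n,j}(x)=r_{n,j}O_{n,j}(x+\alpha_{n,j})$ with $\phi_{n,j}(X)\subseteq X$; and there are constants $0<c_{1,n}\le c_{2,n}<1$ with $c_{1,n}\le r_{n,j}\le c_{2,n}$ for all $1\le j\le N_n$ and $\lim_{n\to\infty}\prod_{j=1}^n c_{2,j}=0$. The metric is the Euclidean one. Attractors. For each $n\ge1$, $K_n=\{\lim_{k\to\infty}\phi_{n,j_n}\circ\cdots\circ\phi_{n+k,j_{n+k}}(a): 1\le j_{n+k}\le N_{n+k},\ k\ge0\}$, a compact set independent of $a\in X$; $\{K_n\}$ is the unique sequence of nonempty compact subsets of $X$ with $K_n=\bigcup_{j=1}^{N_n}\phi_{n,j}(K_{n+1})$ for all $n\ge1$. MOSC. There is a sequence of open sets $V_n\subset X$ such that for all $n\ge1$: $\phi_{n,j}(V_{n+1})\subseteq V_n$ for $1\le j\le N_n$, and $\phi_{n,i}(V_{n+1})\cap\phi_{n,j}(V_{n+1})=\emptyset$ for $1\le i\ne j\le N_n$; and moreover $\inf_{n\ge1}\mathcal{L}^d(V_n)>0$, where $\mathcal{L}^d$ is $d$-dimensional Lebesgue measure. $\mathcal{H}^s$ is $s$-dimensional Hausdorff measure, $\dim_{\rm H}$ is Hausdorff dimension and $\underline{\dim}_{\rm B}$ is lower box dimension. *)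

theory Defs
  imports "HOL-Analysis.Analysis"
begin

section \<open>Hausdorff measure, Hausdorff dimension, lower box dimension\<close>

text \<open>
  The value \<open>|U|^s\<close> with the conventions \<open>|{}|^s = 0\<close> and \<open>0^0 = 1\<close> for nonempty sets of
  diameter zero (\<open>powr\<close> itself has \<open>0 powr 0 = 0\<close>). Only used for bounded \<open>U\<close>, since
  \<open>diameter\<close> is not meaningful for unbounded sets.
\<close>

definition diam_powr :: "real \<Rightarrow> 'a::metric_space set \<Rightarrow> ennreal" where
  "diam_powr s U =
     (if U = {} then 0 else if s = 0 then 1 else ennreal (diameter U powr s))"

definition delta_covers :: "real \<Rightarrow> 'a::metric_space set \<Rightarrow> (nat \<Rightarrow> 'a set) set" where
  "delta_covers \<delta> A =
     {U. A \<subseteq> (\<Union>i. U i) \<and> (\<forall>i. bounded (U i) \<and> diameter (U i) \<le> \<delta>)}"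

definition hausdorff_premeasure :: "real \<Rightarrow> real \<Rightarrow> 'a::metric_space set \<Rightarrow> ennreal" where
  "hausdorff_premeasure s \<delta> A = (INF U\<in>delta_covers \<delta> A. \<Sum>i. diam_powr s (U i))"

text \<open>
  The supremum over \<open>\<delta> > 0\<close> is the limit as \<open>\<delta>\<close> decreases to \<open>0\<close>, by monotonicity.
  No normalising constant is included.
\<close>

definition hausdorff_measure :: "real \<Rightarrow> 'a::metric_space set \<Rightarrow> ennreal" where
  "hausdorff_measure s A = (SUP \<delta>\<in>{0<..}. hausdorff_premeasure s \<delta> A)"

definition hausdorff_dim :: "'a::metric_space set \<Rightarrow> ereal" where
  "hausdorff_dim A = Inf {ereal s | s. 0 \<le> s \<and> hausdorff_measure s A = 0}"

text \<open>
  Least number of sets of diameter at most \<open>\<delta>\<close> needed to cover \<open>A\<close>; intended for totally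
  bounded \<open>A\<close>, for which a finite cover exists.
\<close>

definition covering_number :: "real \<Rightarrow> 'a::metric_space set \<Rightarrow> nat" where
  "covering_number \<delta> A =
     (LEAST m. \<exists>C. finite C \<and> card C = m \<and> A \<subseteq> \<Union>C \<and>
        (\<forall>U\<in>C. bounded U \<and> diameter U \<le> \<delta>))"

definition lower_box_dim :: "'a::metric_space set \<Rightarrow> ereal" where
  "lower_box_dim A =
     Liminf (at_right 0) (\<lambda>\<delta>. ereal (ln (real (covering_number \<delta> A)) / - ln \<delta>))"


section \<open>Moran-type iterated function systems\<close>

text \<open>
  Levels \<open>n\<close> and indices \<open>j\<close> are numbered from \<open>1\<close>: the maps of level \<open>n\<close> are
  \<open>\<phi> n 1, \<dots>, \<phi> n (N n)\<close>. Values at \<open>n = 0\<close>, \<open>j = 0\<close> or \<open>j > N n\<close> are never used.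
\<close>

definition similarity_map ::
  "(nat \<Rightarrow> nat \<Rightarrow> real) \<Rightarrow> (nat \<Rightarrow> nat \<Rightarrow> real^'d^'d) \<Rightarrow> (nat \<Rightarrow> nat \<Rightarrow> real^'d)
    \<Rightarrow> nat \<Rightarrow> nat \<Rightarrow> real^'d \<Rightarrow> real^'d" where
  "similarity_map r Q \<alpha> n j x = r n j *\<^sub>R (Q n j *v (x + \<alpha> n j))"

definition self_similar_MIFS ::
  "(real^'d) set \<Rightarrow> (nat \<Rightarrow> nat) \<Rightarrow> (nat \<Rightarrow> nat \<Rightarrow> real) \<Rightarrow> (nat \<Rightarrow> nat \<Rightarrow> real^'d^'d)
    \<Rightarrow> (nat \<Rightarrow> nat \<Rightarrow> real^'d) \<Rightarrow> bool" where
  "self_similar_MIFS X N r Q \<alpha> \<longleftrightarrow>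
     compact X \<and> X \<noteq> {} \<and>
     (\<forall>n\<ge>1. 2 \<le> N n \<and>
        (\<forall>j\<in>{1..N n}. 0 < r n j \<and> r n j < 1 \<and> orthogonal_matrix (Q n j) \<and>
           similarity_map r Q \<alpha> n j ` X \<subseteq> X)) \<and>
     (\<exists>c1 c2 :: nat \<Rightarrow> real.
        (\<forall>n\<ge>1. 0 < c1 n \<and> c1 n \<le> c2 n \<and> c2 n < 1 \<and>
           (\<forall>j\<in>{1..N n}. c1 n \<le> r n j \<and> r n j \<le> c2 n)) \<and>
        (\<lambda>n. \<Prod>j=1..n. c2 j) \<longlonglongrightarrow> 0)"

text \<open>\<open>comp_maps \<phi> j n k = \<phi> n (j n) \<circ> \<dots> \<circ> \<phi> (n + k) (j (n + k))\<close>\<close>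

primrec comp_maps ::
  "(nat \<Rightarrow> nat \<Rightarrow> 'a \<Rightarrow> 'a) \<Rightarrow> (nat \<Rightarrow> nat) \<Rightarrow> nat \<Rightarrow> nat \<Rightarrow> 'a \<Rightarrow> 'a" where
  "comp_maps \<phi> j n 0 = \<phi> n (j n)"
| "comp_maps \<phi> j n (Suc k) = comp_maps \<phi> j n k \<circ> \<phi> (n + Suc k) (j (n + Suc k))"

text \<open>The set \<open>K\<^sub>n\<close>, with the base point \<open>a\<close> of the limits as a parameter.\<close>

definition attractor ::
  "(nat \<Rightarrow> nat) \<Rightarrow> (nat \<Rightarrow> nat \<Rightarrow> 'a \<Rightarrow> 'a::topological_space) \<Rightarrow> 'a \<Rightarrow> nat \<Rightarrow> 'a set" where
  "attractor N \<phi> a n =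
     {x. \<exists>j. (\<forall>m\<ge>n. j m \<in> {1..N m}) \<and> (\<lambda>k. comp_maps \<phi> j n k a) \<longlonglongrightarrow> x}"

definition MOSC ::
  "'a::euclidean_space set \<Rightarrow> (nat \<Rightarrow> nat) \<Rightarrow> (nat \<Rightarrow> nat \<Rightarrow> 'a \<Rightarrow> 'a) \<Rightarrow> bool" where
  "MOSC X N \<phi> \<longleftrightarrow>
     (\<exists>V :: nat \<Rightarrow> 'a set.
        (\<forall>n\<ge>1. open (V n) \<and> V n \<subseteq> X \<and>
           (\<forall>j\<in>{1..N n}. \<phi> n j ` V (Suc n) \<subseteq> V n) \<and>
           (\<forall>i\<in>{1..N n}. \<forall>j\<in>{1..N n}. i \<noteq> j \<longrightarrow>
              \<phi> n i ` V (Suc n) \<inter> \<phi> n j ` V (Suc n) = {})) \<and>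
        0 < (INF n\<in>{1..}. emeasure lborel (V n)))"

definition moran_prod :: "(nat \<Rightarrow> nat) \<Rightarrow> (nat \<Rightarrow> nat \<Rightarrow> real) \<Rightarrow> nat \<Rightarrow> real \<Rightarrow> real" where
  "moran_prod N r k s = (\<Prod>i=1..k. \<Sum>j=1..N i. r i j powr s)"

definition moran_exponent :: "(nat \<Rightarrow> nat) \<Rightarrow> (nat \<Rightarrow> nat \<Rightarrow> real) \<Rightarrow> nat \<Rightarrow> real" where
  "moran_exponent N r k = (THE s. moran_prod N r k s = 1)"

end

theory Submission
  imports Defs
begin

text \<open>
  Write \<open>P\<^sub>n(s)\<close> for \<open>moran_prod N r n s\<close>. Everything follows from
  \<open>c liminf P\<^sub>n(s) \<le> H\<^sup>s(K\<^sub>1) \<le> C liminf P\<^sub>n(s)\<close>, since \<open>P\<^sub>n(s + t) \<le> P\<^sub>n(s) (\<Prod> c\<^sub>2\<^sub>,\<^sub>i)\<^sup>t\<close>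
  makes \<open>liminf P\<^sub>n(s)\<close> jump from \<open>\<infinity>\<close> to \<open>0\<close> at \<open>liminf s\<^sub>n\<close>. The upper bound uses the covers by
  all cylinders of one level. For the lower bound, give a cylinder of level \<open>n\<close> and ratio \<open>\<rho>\<close>
  the weight \<open>\<rho>\<^sup>s / P\<^sub>n(s)\<close>, which is additive; a set of diameter \<open>\<rho>\<close> meets boundedly many cylinders
  of ratio about \<open>\<rho>\<close>, because these contain disjoint open sets of volume at least a constant times
  \<open>\<rho>\<^sup>d\<close>. The same estimate bounds covering numbers from below, and with equal ratios the
  covers by one level bound them from above.
\<close>

section \<open>Similarities and Hausdorff measure\<close>

lemma similarity_image_ball:
  fixes g :: "'a::metric_space \<Rightarrow> 'a"
  assumes "\<And>x y. dist (g x) (g y) = c * dist x y" "0 < c" "surj g"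
  shows "g ` ball x e = ball (g x) (c * e)"
proof
  show "g ` ball x e \<subseteq> ball (g x) (c * e)" using assms by auto
  show "ball (g x) (c * e) \<subseteq> g ` ball x e"
  proof
    fix y assume "y \<in> ball (g x) (c * e)"
    moreover obtain z where "y = g z" using assms(3) by blast
    ultimately show "y \<in> g ` ball x e" using assms(1,2) by auto
  qed
qed

text \<open>The library computes volumes of linear images only for well-ordered index types. Filling
  \<open>S\<close> with disjoint balls by Vitali's theorem gives the inequality needed here for any type.\<close>

lemma measure_similarity_image_ge:
  fixes g :: "'a::euclidean_space \<Rightarrow> 'a"
  assumes g: "\<And>x y. dist (g x) (g y) = c * dist x y" "0 < c" "surj g"
    and S: "open S" "bounded (g ` S)"
  shows "g ` S \<in> lmeasurable"
    and "c ^ DIM('a) * measure lebesgue S \<le> measure lebesgue (g ` S)"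
proof -
  note g_ball = similarity_image_ball[OF g]
  have "open (g ` S)"
    unfolding open_contains_ball
  proof
    fix y assume "y \<in> g ` S"
    then obtain x where x: "x \<in> S" "y = g x" by blast
    then obtain e where "0 < e" "ball x e \<subseteq> S" using S(1) open_contains_ball by blast
    then have "0 < c * e" "ball y (c * e) \<subseteq> g ` S"
      using g(2) x(2) image_mono[of "ball x e" S g] by (simp_all add: g_ball)
    then show "\<exists>e>0. ball y e \<subseteq> g ` S" by blast
  qed
  with S(2) show gS: "g ` S \<in> lmeasurable" by (rule lmeasurable_open)
  have inj: "inj g"
    using g(1,2) by (metis dist_eq_0_iff injI mult_eq_0_iff less_irrefl)
  \<comment> \<open>All balls inside \<open>S\<close>, indexed by centre and radius: a fine cover of
    \<open>S\<close> in Vitali's sense.\<close>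
  define B where "B = {(x, e) | x e. 0 < e \<and> ball x e \<subseteq> S}"
  have ball_B: "\<exists>i. i \<in> B \<and> x \<in> ball (fst i) (snd i) \<and> snd i < d" if "x \<in> S" "0 < d" for x d
  proof -
    obtain e where e: "0 < e" "ball x e \<subseteq> S" using S(1) \<open>x \<in> S\<close> open_contains_ball by blast
    then have "(x, min e (d / 2)) \<in> B" using \<open>0 < d\<close> by (auto simp: B_def)
    moreover have "min e (d / 2) < d" using \<open>0 < d\<close> by auto
    ultimately show ?thesis using e \<open>0 < d\<close> by (intro exI[of _ "(x, min e (d / 2))"]) auto
  qed
  obtain C where C: "countable C" "C \<subseteq> B"
      "pairwise (\<lambda>i j. disjnt (ball (fst i) (snd i)) (ball (fst j) (snd j))) C"
      "negligible (S - (\<Union>i\<in>C. ball (fst i) (snd i)))"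
    using Vitali_covering_theorem_balls[of S B fst snd, OF ball_B] by blast
  have disj: "disjoint_family_on (\<lambda>i. ball (fst i) (snd i)) C"
    using C(3) by (auto simp: disjoint_family_on_def pairwise_def disjnt_def)
  then have disj': "disjoint_family_on (\<lambda>i. ball (g (fst i)) (c * snd i)) C"
    unfolding g_ball[symmetric] disjoint_family_on_def by (simp add: image_Int[OF inj, symmetric])
  have sub: "(\<Union>i\<in>C. ball (fst i) (snd i)) \<subseteq> S" using C(2) by (fastforce simp: B_def)
  have "emeasure lebesgue S = emeasure lebesgue (\<Union>i\<in>C. ball (fst i) (snd i))"
  proof (rule emeasure_eq_AE)
    have "AE x in lebesgue. x \<notin> S - (\<Union>i\<in>C. ball (fst i) (snd i))"
      using C(4) unfolding negligible_iff_null_sets by (rule AE_not_in)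
    then show "AE x in lebesgue. x \<in> S \<longleftrightarrow> x \<in> (\<Union>i\<in>C. ball (fst i) (snd i))"
      by (rule eventually_mono) (use sub in blast)
    show "S \<in> sets lebesgue" "(\<Union>i\<in>C. ball (fst i) (snd i)) \<in> sets lebesgue"
      using S(1) C(1) by (auto intro!: sets.countable_UN' borel_open)
  qed
  also have "\<dots> = (\<integral>\<^sup>+i. emeasure lebesgue (ball (fst i) (snd i)) \<partial>count_space C)"
    by (rule emeasure_UN_countable) (use C(1) disj in auto)
  finally have "ennreal (c ^ DIM('a)) * emeasure lebesgue S
      = (\<integral>\<^sup>+i. ennreal (c ^ DIM('a)) * emeasure lebesgue (ball (fst i) (snd i)) \<partial>count_space C)"
    by (simp add: nn_integral_cmult)
  also have "\<dots> = (\<integral>\<^sup>+i. emeasure lebesgue (ball (g (fst i)) (c * snd i)) \<partial>count_space C)"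
  proof (rule nn_integral_cong)
    fix i assume "i \<in> space (count_space C)"
    then have "0 < snd i" using C(2) by (auto simp: B_def)
    then show "ennreal (c ^ DIM('a)) * emeasure lebesgue (ball (fst i) (snd i))
        = emeasure lebesgue (ball (g (fst i)) (c * snd i))"
      using g(2) by (simp add: emeasure_ball ennreal_mult[symmetric] power_mult_distrib mult_ac)
  qed
  also have "\<dots> = emeasure lebesgue (\<Union>i\<in>C. ball (g (fst i)) (c * snd i))"
    by (rule emeasure_UN_countable[symmetric]) (use C(1) disj' in auto)
  \<comment> \<open>Monotonicity suffices, so the image of the null set left over by Vitali never
    has to be measured.\<close>
  also have "\<dots> \<le> emeasure lebesgue (g ` S)"
    using sub gS by (intro emeasure_mono) (auto simp: g_ball[symmetric])
  finally have "enn2real (ennreal (c ^ DIM('a)) * emeasure lebesgue S)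
      \<le> measure lebesgue (g ` S)"
    unfolding measure_def using gS by (intro enn2real_mono) (auto simp: fmeasurable_def)
  then show "c ^ DIM('a) * measure lebesgue S \<le> measure lebesgue (g ` S)"
    using g(2) by (simp add: measure_def enn2real_mult)
qed

text \<open>Right continuity of the power function at \<open>D\<close>, where \<open>0 < s\<close>
  covers the case \<open>D = 0\<close>. It lets a covering set be thickened to an open one at cost
  at most \<open>e\<close>.\<close>

lemma powr_upper_approx:
  fixes s D c e :: real
  assumes "0 < s" "0 \<le> D" "D < c" "0 < e"
  obtains x where "D < x" "x < c" "x powr s \<le> D powr s + e"
proof -
  have "((\<lambda>x. x powr s) \<longlongrightarrow> D powr s) (at_right D)"
    using assms by (intro tendsto_powr') (auto simp: eventually_at_filter)
  then have "\<forall>\<^sub>F x in at_right D. x powr s < D powr s + e"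
    using assms(4) by (intro order_tendstoD(2)) auto
  moreover have "\<forall>\<^sub>F x in at_right D. x < c"
    using assms(3) by (intro order_tendstoD(2)[OF tendsto_ident_at])
  moreover have "\<forall>\<^sub>F x in at_right D. D < x"
    by (simp add: eventually_at_filter)
  ultimately have "\<forall>\<^sub>F x in at_right D. D < x \<and> x < c \<and> x powr s \<le> D powr s + e"
    by eventually_elim auto
  then show ?thesis
    using that eventually_happens[of _ "at_right D"] by (auto simp: trivial_limit_at_right_real)
qed

text \<open>Some member of any cover is nonempty and contributes \<open>1\<close>. This settles
  exponent \<open>0\<close>, which the estimates for \<open>0 < s\<close> leave out.\<close>

lemma hausdorff_measure_0_ge_1:
  assumes "A \<noteq> {}"
  shows "1 \<le> hausdorff_measure 0 A"
proof -
  have "1 \<le> hausdorff_premeasure 0 1 A"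
    unfolding hausdorff_premeasure_def
  proof (rule INF_greatest)
    fix U assume "U \<in> delta_covers 1 A"
    then obtain i where i: "U i \<noteq> {}" using assms by (fastforce simp: delta_covers_def)
    have "diam_powr 0 (U i) \<le> (\<Sum>i. diam_powr 0 (U i))"
      using sum_le_suminf[of "\<lambda>i. diam_powr 0 (U i)" "{i}"] by simp
    with i show "1 \<le> (\<Sum>i. diam_powr 0 (U i))" by (simp add: diam_powr_def)
  qed
  also have "\<dots> \<le> hausdorff_measure 0 A"
    unfolding hausdorff_measure_def by (intro SUP_upper) auto
  finally show ?thesis .
qed

lemma diam_powr_pos: "0 < s \<Longrightarrow> diam_powr s U = ennreal (diameter U powr s)"
  by (auto simp: diam_powr_def)

lemma covering_number_le:
  assumes "finite C" "A \<subseteq> \<Union>C" "\<And>U. U \<in> C \<Longrightarrow> bounded U \<and> diameter U \<le> \<delta>"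
  shows "covering_number \<delta> A \<le> card C"
  unfolding covering_number_def using assms by (intro Least_le) auto


section \<open>Cylinders and their overlaps\<close>

text \<open>The hypotheses with all witnesses fixed: \<open>c2\<close> and \<open>V\<close> come
  from the existential statements, \<open>r0\<close> is a uniform lower bound for the ratios,
  \<open>v0\<close> a real lower bound for the volumes of the \<open>V n\<close>.\<close>

locale moran_ifs =
  fixes X :: "(real^'d) set" and N :: "nat \<Rightarrow> nat" and r :: "nat \<Rightarrow> nat \<Rightarrow> real"
    and Q :: "nat \<Rightarrow> nat \<Rightarrow> real^'d^'d" and \<alpha> :: "nat \<Rightarrow> nat \<Rightarrow> real^'d" and a :: "real^'d"
    and c2 :: "nat \<Rightarrow> real" and V :: "nat \<Rightarrow> (real^'d) set" and v0 r0 :: real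
  assumes compact_X: "compact X" and a_in_X: "a \<in> X"
    and two_le_N: "\<And>n. 1 \<le> n \<Longrightarrow> 2 \<le> N n"
    and r0_pos: "0 < r0" and v0_pos: "0 < v0"
    and r0_le: "\<And>n j. 1 \<le> n \<Longrightarrow> j \<in> {1..N n} \<Longrightarrow> r0 \<le> r n j"
    and r_le_c2: "\<And>n j. 1 \<le> n \<Longrightarrow> j \<in> {1..N n} \<Longrightarrow> r n j \<le> c2 n"
    and c2_less_1: "\<And>n. 1 \<le> n \<Longrightarrow> c2 n < 1"
    and prod_c2: "(\<lambda>n. \<Prod>i=1..n. c2 i) \<longlonglongrightarrow> 0"
    and orth: "\<And>n j. 1 \<le> n \<Longrightarrow> j \<in> {1..N n} \<Longrightarrow> orthogonal_matrix (Q n j)"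
    and maps_X: "\<And>n j. 1 \<le> n \<Longrightarrow> j \<in> {1..N n} \<Longrightarrow> similarity_map r Q \<alpha> n j ` X \<subseteq> X"
    and open_V: "\<And>n. 1 \<le> n \<Longrightarrow> open (V n)"
    and V_subset: "\<And>n. 1 \<le> n \<Longrightarrow> V n \<subseteq> X"
    and maps_V: "\<And>n j. 1 \<le> n \<Longrightarrow> j \<in> {1..N n} \<Longrightarrow> similarity_map r Q \<alpha> n j ` V (Suc n) \<subseteq> V n"
    and disj_V: "\<And>n i j. 1 \<le> n \<Longrightarrow> i \<in> {1..N n} \<Longrightarrow> j \<in> {1..N n} \<Longrightarrow> i \<noteq> j \<Longrightarrow>
      similarity_map r Q \<alpha> n i ` V (Suc n) \<inter> similarity_map r Q \<alpha> n j ` V (Suc n) = {}"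
    and v0_le: "\<And>n. 1 \<le> n \<Longrightarrow> v0 \<le> measure lebesgue (V n)"
begin

abbreviation \<phi> :: "nat \<Rightarrow> nat \<Rightarrow> real^'d \<Rightarrow> real^'d" where
  "\<phi> \<equiv> similarity_map r Q \<alpha>"

section \<open>Words, codes and their ratios\<close>

definition K :: "(real^'d) set" where
  "K = attractor N \<phi> a 1"

text \<open>Unlike \<open>comp_maps\<close>, it starts from the empty word, so exactly
  \<open>n\<close> maps are composed; \<open>w 0\<close> is never read.\<close>

primrec word_map :: "(nat \<Rightarrow> nat) \<Rightarrow> nat \<Rightarrow> real^'d \<Rightarrow> real^'d" where
  "word_map w 0 = id"
| "word_map w (Suc n) = word_map w n \<circ> \<phi> (Suc n) (w (Suc n))"

definition ratio :: "(nat \<Rightarrow> nat) \<Rightarrow> nat \<Rightarrow> real" where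
  "ratio w n = (\<Prod>i=1..n. r i (w i))"

definition admissible :: "(nat \<Rightarrow> nat) \<Rightarrow> nat \<Rightarrow> bool" where
  "admissible w n \<longleftrightarrow> (\<forall>i\<in>{1..n}. w i \<in> {1..N i})"

text \<open>Extensional functions represent each finite word exactly once, so sums over
  \<open>words n\<close> have no repetitions.\<close>

definition words :: "nat \<Rightarrow> (nat \<Rightarrow> nat) set" where
  "words n = PiE {1..n} (\<lambda>i. {1..N i})"

text \<open>The value at \<open>0\<close> is pinned so that every coordinate ranges over a finite
  set, which makes \<open>codes\<close> compact.\<close>

definition codes :: "(nat \<Rightarrow> nat) set" where
  "codes = {w. w 0 = 0 \<and> (\<forall>m\<ge>1. w m \<in> {1..N m})}"

definition C2 :: "nat \<Rightarrow> real" where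
  "C2 n = (\<Prod>i=1..n. c2 i)"

text \<open>The summand \<open>1\<close> makes \<open>E\<close> positive outright; a cylinder has
  diameter at most its ratio times \<open>E\<close>.\<close>

definition E :: real where
  "E = diameter X + 1"

lemma E_pos: "0 < E"
  using diameter_ge_0[OF compact_imp_bounded[OF compact_X]] by (simp add: E_def)

lemma dist_X_le: "x \<in> X \<Longrightarrow> y \<in> X \<Longrightarrow> dist x y \<le> E"
  using diameter_bounded_bound[OF compact_imp_bounded[OF compact_X], of x y] by (simp add: E_def)

lemma r_pos: "1 \<le> n \<Longrightarrow> j \<in> {1..N n} \<Longrightarrow> 0 < r n j"
  using r0_le r0_pos by fastforce

lemma r_less_1: "1 \<le> n \<Longrightarrow> j \<in> {1..N n} \<Longrightarrow> r n j < 1"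
  using r_le_c2 c2_less_1 by fastforce

lemma c2_pos: "1 \<le> n \<Longrightarrow> 0 < c2 n"
  using r_pos[of n 1] r_le_c2[of n 1] two_le_N[of n] by fastforce

lemma r0_less_1: "r0 < 1"
  using r0_le[of 1 1] r_less_1[of 1 1] two_le_N[of 1] by fastforce

lemma C2_tendsto: "C2 \<longlonglongrightarrow> 0"
  unfolding C2_def by (rule prod_c2)

lemma C2_pos: "0 < C2 n"
  unfolding C2_def by (intro prod_pos) (auto intro: c2_pos)

section \<open>The level maps as similarities, and their compositions\<close>

lemma dist_\<phi>:
  assumes "1 \<le> n" "j \<in> {1..N n}"
  shows "dist (\<phi> n j x) (\<phi> n j y) = r n j * dist x y"
proof -
  have "\<phi> n j x - \<phi> n j y = r n j *\<^sub>R (Q n j *v (x - y))"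
    by (simp add: similarity_map_def scaleR_diff_right[symmetric]
        matrix_vector_mult_diff_distrib[symmetric])
  moreover have "norm (Q n j *v (x - y)) = norm (x - y)"
    using orth[OF assms] by (simp add: orthogonal_transformation_matrix orthogonal_transformation_norm)
  ultimately show ?thesis
    using r_pos[OF assms] by (simp add: dist_norm)
qed

lemma inj_\<phi>: "1 \<le> n \<Longrightarrow> j \<in> {1..N n} \<Longrightarrow> inj (\<phi> n j)"
  using dist_\<phi> r_pos by (metis dist_eq_0_iff injI mult_eq_0_iff less_irrefl)

lemma surj_\<phi>:
  assumes "1 \<le> n" "j \<in> {1..N n}"
  shows "surj (\<phi> n j)"
proof (rule surjI)
  fix y
  show "\<phi> n j (transpose (Q n j) *v (y /\<^sub>R r n j) - \<alpha> n j) = y"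
    using orth[OF assms] r_pos[OF assms]
    by (simp add: similarity_map_def matrix_vector_mul_assoc orthogonal_matrix_def
        del: transpose_matrix_vector)
qed

lemma word_map_cong: "(\<And>i. i \<in> {1..n} \<Longrightarrow> w i = v i) \<Longrightarrow> word_map w n = word_map v n"
  by (induction n) auto

lemma ratio_cong: "(\<And>i. i \<in> {1..n} \<Longrightarrow> w i = v i) \<Longrightarrow> ratio w n = ratio v n"
  by (auto simp: ratio_def intro!: prod.cong)

lemma ratio_0 [simp]: "ratio w 0 = 1"
  by (simp add: ratio_def)

lemma ratio_Suc: "ratio w (Suc n) = ratio w n * r (Suc n) (w (Suc n))"
  by (simp add: ratio_def)

lemma admissible_mono: "admissible w n \<Longrightarrow> m \<le> n \<Longrightarrow> admissible w m"
  by (auto simp: admissible_def)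

lemma admissible_Suc: "admissible w (Suc n) \<longleftrightarrow> admissible w n \<and> w (Suc n) \<in> {1..N (Suc n)}"
  by (auto simp: admissible_def le_Suc_eq)

lemma admissible_words: "w \<in> words n \<Longrightarrow> admissible w n"
  by (auto simp: admissible_def words_def)

lemma admissible_codes: "w \<in> codes \<Longrightarrow> admissible w n"
  by (auto simp: admissible_def codes_def)

lemma ratio_pos: "admissible w n \<Longrightarrow> 0 < ratio w n"
  unfolding ratio_def admissible_def by (intro prod_pos) (auto intro: r_pos)

lemma ratio_ge_power: "admissible w n \<Longrightarrow> r0 ^ n \<le> ratio w n"
  using prod_mono[of "{1..n}" "\<lambda>_. r0" "\<lambda>i. r i (w i)"] r0_le r0_pos
  by (fastforce simp: ratio_def admissible_def)

lemma ratio_le_C2: "admissible w n \<Longrightarrow> ratio w n \<le> C2 n"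
  unfolding ratio_def admissible_def C2_def
  by (intro prod_mono) (force intro: r_le_c2 less_imp_le[OF r_pos])

lemma dist_word_map: "admissible w n \<Longrightarrow> dist (word_map w n x) (word_map w n y) = ratio w n * dist x y"
  by (induction n arbitrary: x y) (simp_all add: admissible_Suc dist_\<phi> ratio_Suc)

lemma inj_word_map: "admissible w n \<Longrightarrow> inj (word_map w n)"
  by (induction n) (auto simp: admissible_Suc intro!: inj_compose inj_\<phi>)

lemma surj_word_map: "admissible w n \<Longrightarrow> surj (word_map w n)"
proof (induction n)
  case (Suc n)
  then show ?case
    using comp_surj[of "\<phi> (Suc n) (w (Suc n))" "word_map w n"]
    by (simp add: admissible_Suc surj_\<phi> comp_def)
qed simp

text \<open>Taking a sequence \<open>A\<close> lets one induction serve both the constant set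
  \<open>X\<close> and the sets \<open>V n\<close>.\<close>

lemma word_map_nested:
  assumes "\<And>n j. 1 \<le> n \<Longrightarrow> j \<in> {1..N n} \<Longrightarrow> \<phi> n j ` A (Suc n) \<subseteq> A n"
    and "admissible w n" "m \<le> n"
  shows "word_map w n ` A (Suc n) \<subseteq> word_map w m ` A (Suc m)"
  using assms(3,2)
proof (induction rule: dec_induct)
  case (step k)
  then have "\<phi> (Suc k) (w (Suc k)) ` A (Suc (Suc k)) \<subseteq> A (Suc k)"
    using assms(1)[of "Suc k"] by (auto simp: admissible_Suc)
  then have "word_map w (Suc k) ` A (Suc (Suc k)) \<subseteq> word_map w k ` A (Suc k)"
    by (force simp: image_comp[symmetric])
  with step show ?case by (auto simp: admissible_Suc)
qed simp

lemma word_map_nested_X: "admissible w n \<Longrightarrow> m \<le> n \<Longrightarrow> word_map w n ` X \<subseteq> word_map w m ` X"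
  by (rule word_map_nested[of "\<lambda>_. X", OF maps_X])

lemma word_map_nested_V:
  "admissible w n \<Longrightarrow> m \<le> n \<Longrightarrow> word_map w n ` V (Suc n) \<subseteq> word_map w m ` V (Suc m)"
  by (rule word_map_nested[of V, OF maps_V])

lemma word_map_X_subset: "admissible w n \<Longrightarrow> word_map w n ` X \<subseteq> X"
  using word_map_nested_X[of w n 0] by simp

lemma dist_word_map_X:
  assumes "admissible w n" "x \<in> word_map w n ` X" "y \<in> word_map w n ` X"
  shows "dist x y \<le> ratio w n * E"
  using assms dist_X_le ratio_pos[OF assms(1)] by (auto simp: dist_word_map)

text \<open>At the first level where the words differ, \<open>disj_V\<close> separates the two
  images; the common map before that level is injective, and everything deeper is nested inside. The
  lengths \<open>m\<close> and \<open>n\<close> may differ.\<close>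

lemma disjoint_word_map_V:
  assumes "admissible u m" "admissible v n" "i \<in> {1..m}" "i \<le> n" "u i \<noteq> v i"
  shows "word_map u m ` V (Suc m) \<inter> word_map v n ` V (Suc n) = {}"
proof -
  define l where "l = (LEAST l. 1 \<le> l \<and> u l \<noteq> v l)"
  have l: "1 \<le> l" "u l \<noteq> v l" "l \<le> i"
    using LeastI[of "\<lambda>l. 1 \<le> l \<and> u l \<noteq> v l" i] Least_le[of "\<lambda>l. 1 \<le> l \<and> u l \<noteq> v l" i] assms
    by (auto simp: l_def)
  have eq: "u k = v k" if "1 \<le> k" "k < l" for k
    using not_less_Least[of k "\<lambda>l. 1 \<le> l \<and> u l \<noteq> v l"] that by (auto simp: l_def)
  obtain k where k: "l = Suc k" using l by (cases l) auto
  have g: "word_map u k = word_map v k"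
    by (rule word_map_cong) (use eq k in auto)
  have lu: "u l \<in> {1..N l}" "v l \<in> {1..N l}"
    using assms l unfolding admissible_def by auto
  have "word_map u m ` V (Suc m) \<subseteq> word_map u l ` V (Suc l)"
    using assms l by (intro word_map_nested_V) auto
  moreover have "word_map v n ` V (Suc n) \<subseteq> word_map v l ` V (Suc l)"
    using assms l by (intro word_map_nested_V) auto
  moreover have "word_map u l ` V (Suc l) = word_map u k ` \<phi> l (u l) ` V (Suc l)"
    "word_map v l ` V (Suc l) = word_map u k ` \<phi> l (v l) ` V (Suc l)"
    by (auto simp: k g image_comp)
  moreover have "inj (word_map u k)"
    using assms l k by (intro inj_word_map) (auto intro: admissible_mono)
  ultimately show ?thesis
    using disj_V[OF l(1) lu l(2)]
      image_Int[of "word_map u k" "\<phi> l (u l) ` V (Suc l)" "\<phi> l (v l) ` V (Suc l)"]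
    by (metis Int_mono image_empty subset_empty)
qed

lemma word_map_V:
  assumes "admissible w n"
  shows "word_map w n ` V (Suc n) \<in> lmeasurable"
    and "ratio w n ^ CARD('d) * v0 \<le> measure lebesgue (word_map w n ` V (Suc n))"
proof -
  have V: "open (V (Suc n))" "V (Suc n) \<subseteq> X"
    using open_V[of "Suc n"] V_subset[of "Suc n"] by auto
  have "word_map w n ` V (Suc n) \<subseteq> X"
    using word_map_X_subset[OF assms] V(2) by auto
  then have "bounded (word_map w n ` V (Suc n))"
    using bounded_subset compact_imp_bounded[OF compact_X] by blast
  note sim = measure_similarity_image_ge[OF dist_word_map[OF assms] ratio_pos[OF assms]
      surj_word_map[OF assms] V(1) this]
  show "word_map w n ` V (Suc n) \<in> lmeasurable" by (rule sim)
  have "ratio w n ^ CARD('d) * v0 \<le> ratio w n ^ CARD('d) * measure lebesgue (V (Suc n))"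
    using v0_le[of "Suc n"] ratio_pos[OF assms] by (intro mult_left_mono) auto
  also have "\<dots> \<le> measure lebesgue (word_map w n ` V (Suc n))"
    using sim(2) by simp
  finally show "ratio w n ^ CARD('d) * v0 \<le> measure lebesgue (word_map w n ` V (Suc n))" .
qed

lemma finite_words: "finite (words n)"
  unfolding words_def by (intro finite_PiE) auto

text \<open>The volume of a ball of radius \<open>\<rho> * (1 + E)\<close> divided by
  \<open>(r0 * \<rho>) ^ CARD('d) * v0\<close>; the scale \<rho> cancels.\<close>

definition overlap_bound :: real where
  "overlap_bound = unit_ball_vol (real CARD('d)) * ((1 + E) / r0) ^ CARD('d) / v0"

lemma overlap_bound_pos: "0 < overlap_bound"
  using E_pos r0_pos v0_pos by (auto simp: overlap_bound_def intro!: mult_pos_pos divide_pos_pos zero_less_power add_pos_pos)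

text \<open>Volume comparison. By \<open>disj\<close> no word in \<open>P\<close> is a prefix of
  another, so the images of the sets \<open>V (Suc n)\<close> are disjoint; each has volume at least
  \<open>(r0 * \<rho>) ^ CARD('d) * v0\<close>, and all lie in one ball. Pairs carry the length,
  which \<open>p\<close> alone does not determine.\<close>

lemma card_le_overlap_bound:
  fixes P :: "((nat \<Rightarrow> nat) \<times> nat) set"
  assumes fin: "finite P" and \<rho>: "0 < \<rho>" and U: "\<And>x y. x \<in> U \<Longrightarrow> y \<in> U \<Longrightarrow> dist x y \<le> \<rho>"
    and P: "\<And>p n. (p, n) \<in> P \<Longrightarrow> admissible p n \<and> r0 * \<rho> \<le> ratio p n \<and> ratio p n \<le> \<rho> \<and>
      word_map p n ` X \<inter> U \<noteq> {}"
    and disj: "\<And>p m q n. (p, m) \<in> P \<Longrightarrow> (q, n) \<in> P \<Longrightarrow> (p, m) \<noteq> (q, n) \<Longrightarrow> m \<le> n \<Longrightarrow>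
      \<exists>i\<in>{1..m}. p i \<noteq> q i"
  shows "real (card P) \<le> overlap_bound"
proof (cases "P = {}")
  case True
  then show ?thesis using overlap_bound_pos by simp
next
  case False
  then obtain x0 where x0: "x0 \<in> U" using P by fastforce
  let ?A = "\<lambda>(p, n). word_map p n ` V (Suc n)"
  have meas: "?A q \<in> lmeasurable" if "q \<in> P" for q
    using that P word_map_V(1) by (cases q) auto
  have "real (card P) * ((r0 * \<rho>) ^ CARD('d) * v0) = (\<Sum>q\<in>P. (r0 * \<rho>) ^ CARD('d) * v0)"
    by simp
  also have "\<dots> \<le> (\<Sum>q\<in>P. measure lebesgue (?A q))"
  proof (rule sum_mono)
    fix q assume "q \<in> P"
    obtain p n where q: "q = (p, n)" by fastforce
    with P \<open>q \<in> P\<close> have p: "admissible p n" "r0 * \<rho> \<le> ratio p n" by auto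
    have "(r0 * \<rho>) ^ CARD('d) * v0 \<le> ratio p n ^ CARD('d) * v0"
      using p r0_pos \<rho> v0_pos by (intro mult_right_mono power_mono) auto
    with word_map_V(2)[OF p(1)] show "(r0 * \<rho>) ^ CARD('d) * v0 \<le> measure lebesgue (?A q)"
      by (simp add: q)
  qed
  also have "\<dots> = measure lebesgue (\<Union>q\<in>P. ?A q)"
  proof (rule measure_UNION'[symmetric, OF fin meas])
    show "pairwise (\<lambda>i j. disjnt (?A i) (?A j)) P"
    proof (rule pairwiseI)
      fix p' q' assume *: "p' \<in> P" "q' \<in> P" "p' \<noteq> q'"
      obtain p m q n where pq: "p' = (p, m)" "q' = (q, n)" by fastforce
      consider "m \<le> n" | "n \<le> m" by linarith
      then show "disjnt (?A p') (?A q')"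
      proof cases
        case 1
        then obtain i where "i \<in> {1..m}" "p i \<noteq> q i" using disj[of p m q n] * pq by auto
        with 1 * P pq show ?thesis
          using disjoint_word_map_V[of p m q n i] by (auto simp: disjnt_def)
      next
        case 2
        then obtain i where "i \<in> {1..n}" "q i \<noteq> p i" using disj[of q n p m] * pq by auto
        with 2 * P pq show ?thesis
          using disjoint_word_map_V[of q n p m i] by (auto simp: disjnt_def)
      qed
    qed
  qed
  also have "\<dots> \<le> measure lebesgue (cball x0 (\<rho> * (1 + E)))"
  proof (rule measure_mono_fmeasurable)
    show "(\<Union>q\<in>P. ?A q) \<subseteq> cball x0 (\<rho> * (1 + E))"
    proof
      fix z assume "z \<in> (\<Union>q\<in>P. ?A q)"
      then obtain p n where p: "(p, n) \<in> P" "z \<in> word_map p n ` V (Suc n)" by auto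
      \<comment> \<open>A common point of \<open>U\<close> and the cylinder links \<open>x0\<close>
        to \<open>z\<close>: at most \<rho> inside \<open>U\<close>, then at most
        \<open>\<rho> * E\<close> inside the cylinder.\<close>
      then obtain y where y: "y \<in> U" "y \<in> word_map p n ` X" using P by blast
      have "z \<in> word_map p n ` X" using p V_subset[of "Suc n"] by auto
      then have "dist y z \<le> ratio p n * E" using dist_word_map_X y p P by blast
      also have "\<dots> \<le> \<rho> * E" using P p E_pos by (intro mult_right_mono) auto
      finally have "dist y z \<le> \<rho> * E" .
      with U[OF x0 y(1)] dist_triangle[of x0 z y] show "z \<in> cball x0 (\<rho> * (1 + E))"
        by (simp add: algebra_simps)
    qed
    show "(\<Union>q\<in>P. ?A q) \<in> sets lebesgue"
      using meas fin by (intro sets.finite_UN) (auto dest: fmeasurableD)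
  qed auto
  also have "\<dots> = unit_ball_vol (real CARD('d)) * (\<rho> * (1 + E)) ^ CARD('d)"
    using \<rho> E_pos by (simp add: content_cball)
  finally have "real (card P) * ((r0 * \<rho>) ^ CARD('d) * v0)
    \<le> unit_ball_vol (real CARD('d)) * (\<rho> * (1 + E)) ^ CARD('d)" .
  then have "real (card P) * (r0 ^ CARD('d) * v0)
    \<le> unit_ball_vol (real CARD('d)) * (1 + E) ^ CARD('d)"
    using \<rho> by (simp add: power_mult_distrib)
  then show ?thesis
    using r0_pos v0_pos by (simp add: overlap_bound_def power_divide field_simps)
qed


section \<open>The natural weights\<close>

lemma moran_prod_pos: "0 < moran_prod N r n s"
proof -
  have "0 < (\<Sum>j=1..N i. r i j powr s)" if "1 \<le> i" for i
    using two_le_N[OF that] r_pos[OF that]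
    by (intro sum_pos) (auto dest: less_imp_neq[symmetric])
  then show ?thesis
    unfolding moran_prod_def by (intro prod_pos) auto
qed

text \<open>Mass of a cylinder under the product of the probability vectors proportional to
  \<open>r i j powr s\<close>. In product form, sums over extensions factor level by level.\<close>

definition weight :: "real \<Rightarrow> (nat \<Rightarrow> nat) \<Rightarrow> nat \<Rightarrow> real" where
  "weight s w n = (\<Prod>i=1..n. r i (w i) powr s / (\<Sum>j=1..N i. r i j powr s))"

lemma weight_eq: "admissible w n \<Longrightarrow> weight s w n = ratio w n powr s / moran_prod N r n s"
  unfolding weight_def moran_prod_def ratio_def prod_dividef
  by (subst prod_powr_distrib) (auto simp: admissible_def intro: less_imp_le r_pos)

lemma weight_nonneg: "0 \<le> weight s w n"
  unfolding weight_def by (intro prod_nonneg) (auto intro!: divide_nonneg_nonneg sum_nonneg)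

text \<open>The extensions form a product of finite sets, so the sum is a product of level sums;
  fixed levels give the factors of \<open>weight s p n\<close>, and each free level sums to
  \<open>1\<close>.\<close>

lemma sum_weight_extensions:
  assumes "admissible p n" "n \<le> T"
  shows "(\<Sum>v | v \<in> words T \<and> (\<forall>i\<in>{1..n}. v i = p i). weight s v T) = weight s p n"
proof -
  let ?q = "\<lambda>i j. r i j powr s / (\<Sum>j=1..N i. r i j powr s)"
  let ?B = "\<lambda>i. if i \<le> n then {p i} else {1..N i}"
  have set: "{v. v \<in> words T \<and> (\<forall>i\<in>{1..n}. v i = p i)} = PiE {1..T} ?B"
  proof (intro set_eqI iffI)
    fix v assume "v \<in> PiE {1..T} ?B"
    then have v: "\<And>i. i \<in> {1..T} \<Longrightarrow> v i \<in> ?B i" "v \<in> extensional {1..T}"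
      by (auto simp only: PiE_iff)
    have eq: "v i = p i" if "i \<in> {1..n}" for i using v(1)[of i] that assms(2) by simp
    moreover have "v i \<in> {1..N i}" if "i \<in> {1..T}" for i
      using v(1)[OF that] eq[of i] assms(1) that by (cases "i \<le> n") (auto simp: admissible_def)
    ultimately show "v \<in> {v. v \<in> words T \<and> (\<forall>i\<in>{1..n}. v i = p i)}"
      using v(2) by (simp add: words_def PiE_iff)
  qed (auto simp: words_def PiE_iff)
  have sum1: "(\<Sum>j\<in>{1..N i}. ?q i j) = 1" if "1 \<le> i" for i
  proof -
    have "0 < (\<Sum>j=1..N i. r i j powr s)"
      using two_le_N[OF that] r_pos[OF that]
      by (intro sum_pos) (auto dest: less_imp_neq[symmetric])
    then show ?thesis by (simp add: sum_divide_distrib[symmetric])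
  qed
  have "(\<Sum>v\<in>PiE {1..T} ?B. weight s v T) = (\<Prod>i=1..T. \<Sum>j\<in>?B i. ?q i j)"
    unfolding weight_def by (rule prod_sum_PiE[symmetric]) auto
  also have "\<dots> = (\<Prod>i=1..T. if i \<le> n then ?q i (p i) else 1)"
    using sum1 by (intro prod.cong) auto
  also have "\<dots> = (\<Prod>i\<in>{i\<in>{1..T}. i \<le> n}. ?q i (p i))"
    by (rule prod.inter_filter[symmetric]) simp
  also have "{i\<in>{1..T}. i \<le> n} = {1..n}" using assms(2) by auto
  finally show ?thesis unfolding set weight_def .
qed

lemma sum_weight: "(\<Sum>v\<in>words T. weight s v T) = 1"
  using sum_weight_extensions[of _ 0 T s] by (simp add: admissible_def weight_def)

text \<open>The Frostman-type estimate: every word \<open>v\<close> is cut at the first level \<open>stop v\<close> at which its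
  ratio drops to \<open>\<rho>\<close>; the truncated words are few by volume, and each of them has weight
  at most \<open>\<rho> powr s / b\<close>.\<close>

lemma weight_meeting_le:
  assumes s: "0 \<le> s" and b: "0 < b" "\<And>n. n0 \<le> n \<Longrightarrow> b \<le> moran_prod N r n s"
    and \<rho>: "0 < \<rho>" "\<rho> < r0 ^ n0" and T: "C2 T \<le> \<rho>"
    and U: "\<And>x y. x \<in> U \<Longrightarrow> y \<in> U \<Longrightarrow> dist x y \<le> \<rho>"
  shows "(\<Sum>v | v \<in> words T \<and> word_map v T ` X \<inter> U \<noteq> {}. weight s v T)
    \<le> overlap_bound * (\<rho> powr s / b)"
proof -
  define stop where "stop v = (LEAST n. ratio v n \<le> \<rho>)" for v
  \<comment> \<open>Restricting makes words with a common truncation have equal first components;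
    the second component records the length.\<close>
  define cut where "cut v = (restrict v {1..stop v}, stop v)" for v
  define W where "W = {v. v \<in> words T \<and> word_map v T ` X \<inter> U \<noteq> {}}"
  have fin: "finite W" using finite_words by (simp add: W_def)
  have W: "v \<in> words T" "word_map v T ` X \<inter> U \<noteq> {}" if "v \<in> W" for v
    using that by (auto simp: W_def)
  have "\<rho> < 1"
    using \<rho>(2) power_le_one[of r0 n0] r0_pos r0_less_1 by linarith
  \<comment> \<open>\<open>ratio v 0 = 1\<close> exceeds \<rho>, so the stopping level is not
    \<open>0\<close>. One level earlier the ratio still exceeds \<rho>, and the last factor is at
    least \<open>r0\<close>. Below level \<open>n0\<close> ratios are at least
    \<open>r0 ^ n0\<close>, hence above \<rho>, so \<open>b\<close> bounds \<open>moran_prod\<close>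
    at level \<open>stop v\<close>.\<close>
  have stop: "ratio v (stop v) \<le> \<rho>" "stop v \<le> T" "stop v \<noteq> 0" "r0 * \<rho> \<le> ratio v (stop v)"
      "n0 \<le> stop v" if v: "v \<in> words T" for v
  proof -
    note adm = admissible_words[OF v]
    have T': "ratio v T \<le> \<rho>" using ratio_le_C2[OF adm] T by linarith
    show le: "ratio v (stop v) \<le> \<rho>" unfolding stop_def using T' by (rule LeastI)
    show leT: "stop v \<le> T" unfolding stop_def using T' by (rule Least_le)
    show pos: "stop v \<noteq> 0" using le \<open>\<rho> < 1\<close> by (intro notI) simp
    obtain k where k: "stop v = Suc k" using pos not0_implies_Suc by blast
    then have "\<not> ratio v k \<le> \<rho>"
      using not_less_Least[of k "\<lambda>n. ratio v n \<le> \<rho>"] by (simp add: stop_def[symmetric])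
    then show "r0 * \<rho> \<le> ratio v (stop v)"
      using r0_le[of "Suc k" "v (Suc k)"] admissible_mono[OF adm leT] r0_pos \<rho>
      by (simp add: k ratio_Suc admissible_Suc mult.commute[of r0] mult_mono)
    show "n0 \<le> stop v"
    proof (rule ccontr)
      assume "\<not> n0 \<le> stop v"
      then have "r0 ^ n0 \<le> r0 ^ stop v" using r0_pos r0_less_1 by (intro power_decreasing) auto
      with ratio_ge_power[OF admissible_mono[OF adm leT]] le \<rho>(2) show False by linarith
    qed
  qed
  have cut_eq: "admissible p n" "ratio p n = ratio v (stop v)" "word_map p n = word_map v (stop v)"
      "n = stop v" "\<And>i. i \<in> {1..n} \<Longrightarrow> v i = p i"
    if "v \<in> words T" "(p, n) = cut v" for v p n
  proof -
    have *: "p = restrict v {1..stop v}" "n = stop v" using that by (auto simp: cut_def)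
    show "n = stop v" "\<And>i. i \<in> {1..n} \<Longrightarrow> v i = p i" using * by auto
    show "admissible p n" using admissible_mono[OF admissible_words[OF that(1)] stop(2)[OF that(1)]]
      by (auto simp: * admissible_def)
    show "ratio p n = ratio v (stop v)" "word_map p n = word_map v (stop v)"
      unfolding * by (auto intro!: ratio_cong word_map_cong)
  qed
  have "(\<Sum>v\<in>W. weight s v T) = (\<Sum>q\<in>cut ` W. \<Sum>v | v \<in> W \<and> cut v = q. weight s v T)"
    by (rule sum.image_gen[OF fin, of "\<lambda>v. weight s v T" cut])
  also have "\<dots> \<le> (\<Sum>q\<in>cut ` W. \<rho> powr s / b)"
  proof (rule sum_mono)
    fix q assume "q \<in> cut ` W"
    then obtain w where "w \<in> W" "q = cut w" by (rule imageE)
    moreover obtain p n where "q = (p, n)" by (rule prod.exhaust)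
    ultimately have w: "w \<in> W" "(p, n) = cut w" "q = (p, n)" by auto
    note cw = cut_eq[OF W(1)[OF w(1)] w(2)] and sw = stop[OF W(1)[OF w(1)]]
    \<comment> \<open>All words with this truncation extend \<open>p\<close>, so additivity bounds
      their total weight by that of \<open>p\<close>.\<close>
    have "(\<Sum>v | v \<in> W \<and> cut v = q. weight s v T)
        \<le> (\<Sum>v | v \<in> words T \<and> (\<forall>i\<in>{1..n}. v i = p i). weight s v T)"
    proof (rule sum_mono2)
      show "{v \<in> W. cut v = q} \<subseteq> {v. v \<in> words T \<and> (\<forall>i\<in>{1..n}. v i = p i)}"
        using W(1) cut_eq(5)[of _ p n] w(3) by fastforce
    qed (use finite_words weight_nonneg in auto)
    also have "\<dots> = weight s p n"
      by (rule sum_weight_extensions) (use cw sw in auto)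
    also have "\<dots> = ratio p n powr s / moran_prod N r n s"
      using cw by (intro weight_eq) auto
    also have "\<dots> \<le> \<rho> powr s / b"
      using cw sw b s less_imp_le[OF ratio_pos[of p n]]
      by (intro frac_le powr_mono2) auto
    finally show "(\<Sum>v | v \<in> W \<and> cut v = q. weight s v T) \<le> \<rho> powr s / b" .
  qed
  also have "\<dots> = real (card (cut ` W)) * (\<rho> powr s / b)" by simp
  also have "\<dots> \<le> overlap_bound * (\<rho> powr s / b)"
  proof (intro mult_right_mono card_le_overlap_bound[OF _ \<rho>(1) U])
    show "finite (cut ` W)" using fin by simp
    show "admissible p n \<and> r0 * \<rho> \<le> ratio p n \<and> ratio p n \<le> \<rho> \<and> word_map p n ` X \<inter> U \<noteq> {}"
      if pn: "(p, n) \<in> cut ` W" for p n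
    proof -
      obtain v where v: "(p, n) = cut v" "v \<in> W" using pn by (rule imageE)
      have "word_map v T ` X \<subseteq> word_map v (stop v) ` X"
        using W(1)[OF v(2)] stop by (intro word_map_nested_X admissible_words) auto
      then show ?thesis
        using W[OF v(2)] cut_eq[OF W(1)[OF v(2)] v(1)] stop[OF W(1)[OF v(2)]] by auto
    qed
    \<comment> \<open>Were \<open>p\<close> a prefix of \<open>q\<close>, the ratio of
      \<open>v\<close> would have dropped to \<rho> by level \<open>m\<close>, so
      \<open>n = stop v\<close> would be at most \<open>m\<close> and the two truncations would
      coincide.\<close>
    show "\<exists>i\<in>{1..m}. p i \<noteq> q i"
      if pm: "(p, m) \<in> cut ` W" and qn: "(q, n) \<in> cut ` W" and ne: "(p, m) \<noteq> (q, n)"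
        and "m \<le> n" for p m q n
    proof (rule ccontr)
      assume "\<not> ?thesis"
      then have eq: "p i = q i" if "i \<in> {1..m}" for i using that by blast
      obtain u where u: "(p, m) = cut u" "u \<in> W" using pm by (rule imageE)
      obtain v where v: "(q, n) = cut v" "v \<in> W" using qn by (rule imageE)
      have uv: "u i = v i" if "i \<in> {1..m}" for i
        using that eq[OF that] cut_eq(5)[OF W(1)[OF u(2)] u(1)] cut_eq(5)[OF W(1)[OF v(2)] v(1)]
          \<open>m \<le> n\<close> by simp
      then have "ratio v m = ratio u m" by (intro ratio_cong) auto
      then have "ratio v m \<le> \<rho>" using cut_eq(4)[OF W(1)[OF u(2)] u(1)] stop(1)[OF W(1)[OF u(2)]] by simp
      then have "n \<le> m" using cut_eq(4)[OF W(1)[OF v(2)] v(1)] by (simp add: stop_def Least_le)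
      then have "m = n" using \<open>m \<le> n\<close> by simp
      moreover have "p = q"
        using u v uv \<open>m = n\<close> by (auto simp: cut_def restrict_def fun_eq_iff)
      ultimately show False using ne by simp
    qed
  qed (use b in auto)
  finally show ?thesis unfolding W_def .
qed

section \<open>Compactness of the attractor\<close>

definition code_point :: "(nat \<Rightarrow> nat) \<Rightarrow> real^'d" where
  "code_point w = lim (\<lambda>n. word_map w n a)"

lemma word_map_a_mem:
  assumes "w \<in> codes" "m \<le> n"
  shows "word_map w n a \<in> word_map w m ` X"
  using word_map_nested_X[OF admissible_codes[OF assms(1)] assms(2)] a_in_X by auto

text \<open>Cylinders along a code are nested with diameters at most \<open>C2 n * E\<close>, so the
  images of \<open>a\<close> form a Cauchy sequence.\<close>

lemma code_point_tendsto:
  assumes w: "w \<in> codes"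
  shows "(\<lambda>n. word_map w n a) \<longlonglongrightarrow> code_point w"
proof -
  have "Cauchy (\<lambda>n. word_map w n a)"
  proof (rule metric_CauchyI)
    fix e :: real assume "0 < e"
    have "(\<lambda>n. C2 n * E) \<longlonglongrightarrow> 0 * E"
      by (intro tendsto_intros C2_tendsto)
    with \<open>0 < e\<close> have "\<forall>\<^sub>F n in sequentially. C2 n * E < e"
      by (intro order_tendstoD(2)) auto
    then obtain M where M: "C2 M * E < e" by (auto simp: eventually_sequentially)
    have "dist (word_map w m a) (word_map w n a) < e" if "M \<le> m" "M \<le> n" for m n
    proof -
      have "dist (word_map w m a) (word_map w n a) \<le> ratio w M * E"
        using that by (intro dist_word_map_X admissible_codes word_map_a_mem w)
      also have "\<dots> \<le> C2 M * E"
        using ratio_le_C2[OF admissible_codes[OF w]] E_pos by (intro mult_right_mono) auto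
      finally show ?thesis using M by simp
    qed
    then show "\<exists>M. \<forall>m\<ge>M. \<forall>n\<ge>M. dist (word_map w m a) (word_map w n a) < e" by blast
  qed
  then show ?thesis
    unfolding code_point_def by (simp add: Cauchy_convergent_iff convergent_LIMSEQ_iff)
qed

lemma code_point_mem:
  assumes w: "w \<in> codes"
  shows "code_point w \<in> word_map w n ` X"
proof (rule Lim_in_closed_set)
  have "continuous_on X (word_map w n)"
    using dist_word_map[OF admissible_codes[OF w], of n] less_imp_le[OF ratio_pos[OF admissible_codes[OF w], of n]]
    by (intro lipschitz_on_continuous_on[of "ratio w n"] lipschitz_onI) auto
  then show "closed (word_map w n ` X)"
    using compact_X by (intro compact_imp_closed compact_continuous_image)
  show "\<forall>\<^sub>F m in sequentially. word_map w m a \<in> word_map w n ` X"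
    using word_map_a_mem[OF w] by (auto simp: eventually_sequentially)
qed (use code_point_tendsto[OF w] in auto)

lemma comp_maps_eq_word_map: "comp_maps \<phi> w 1 k = word_map w (Suc k)"
  by (induction k) auto

lemma K_eq: "K = code_point ` codes"
proof
  show "K \<subseteq> code_point ` codes"
  proof
    fix x assume "x \<in> K"
    then obtain j where j: "\<And>m. 1 \<le> m \<Longrightarrow> j m \<in> {1..N m}" "(\<lambda>k. word_map j (Suc k) a) \<longlonglongrightarrow> x"
      unfolding K_def attractor_def comp_maps_eq_word_map by blast
    \<comment> \<open>\<open>attractor\<close> leaves \<open>j 0\<close> free; resetting it to the
      value prescribed by \<open>codes\<close> changes no word map.\<close>
    have w: "j(0 := 0) \<in> codes" using j(1) by (auto simp: codes_def)
    have "word_map (j(0 := 0)) n = word_map j n" for n by (intro word_map_cong) auto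
    then have "code_point (j(0 := 0)) = x"
      using LIMSEQ_unique[OF LIMSEQ_Suc[OF code_point_tendsto[OF w]]] j(2) by simp
    with w show "x \<in> code_point ` codes" by blast
  qed
  show "code_point ` codes \<subseteq> K"
  proof
    fix x assume "x \<in> code_point ` codes"
    then obtain w where w: "w \<in> codes" "x = code_point w" by blast
    then have "\<forall>m\<ge>1. w m \<in> {1..N m}" by (simp add: codes_def)
    with LIMSEQ_Suc[OF code_point_tendsto[OF w(1)]] w(2) show "x \<in> K"
      unfolding K_def attractor_def comp_maps_eq_word_map by blast
  qed
qed

text \<open>Tychonoff's theorem, each coordinate ranging over a finite set.\<close>

lemma compact_codes: "compact codes"
proof -
  let ?S = "\<lambda>i. if i = 0 then {0} else {1..N i}"
  have "compactin (product_topology (\<lambda>i. euclidean) UNIV) (PiE UNIV ?S)"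
    by (subst compactin_PiE) (auto intro: finite_imp_compact)
  moreover have "PiE UNIV ?S = codes"
  proof (intro set_eqI iffI)
    fix w assume "w \<in> PiE UNIV ?S"
    then have w: "w i \<in> ?S i" for i by (rule PiE_mem) simp
    have "w m \<in> {1..N m}" if "1 \<le> m" for m using w[of m] that by simp
    with w[of 0] show "w \<in> codes" by (simp add: codes_def)
  qed (auto simp: codes_def)
  ultimately show ?thesis by (simp add: euclidean_product_topology)
qed

text \<open>Fixing the first \<open>n\<close> letters is an open condition in the product topology
  and confines the point to one cylinder of diameter at most \<open>C2 n * E\<close>.\<close>

lemma continuous_on_code_point: "continuous_on codes code_point"
  unfolding continuous_on_topological
proof (intro ballI allI impI)
  fix w B assume w: "w \<in> codes" and B: "open B" "code_point w \<in> B"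
  obtain e where e: "0 < e" "ball (code_point w) e \<subseteq> B" using B open_contains_ball by blast
  have "(\<lambda>n. C2 n * E) \<longlonglongrightarrow> 0 * E"
    by (intro tendsto_intros C2_tendsto)
  with e(1) have "\<forall>\<^sub>F n in sequentially. C2 n * E < e"
    by (intro order_tendstoD(2)) auto
  then obtain n where n: "C2 n * E < e" by (auto simp: eventually_sequentially)
  let ?S = "\<lambda>i. if i \<in> {1..n} then {w i} else UNIV"
  have "finite {i. ?S i \<noteq> UNIV}" by (rule finite_subset[of _ "{1..n}"]) auto
  then have "open (PiE UNIV ?S)" by (intro open_PiE) (auto simp: open_discrete)
  moreover have "w \<in> PiE UNIV ?S" by auto
  moreover have "code_point v \<in> B" if "v \<in> codes" "v \<in> PiE UNIV ?S" for v
  proof -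
    have "v i = w i" if "i \<in> {1..n}" for i
    proof -
      have "v i \<in> ?S i" using \<open>v \<in> PiE UNIV ?S\<close> by (rule PiE_mem) simp
      with that show ?thesis by simp
    qed
    then have "word_map v n = word_map w n" by (rule word_map_cong)
    then have "dist (code_point w) (code_point v) \<le> ratio w n * E"
      using code_point_mem[OF w, of n] code_point_mem[OF that(1), of n]
      by (intro dist_word_map_X admissible_codes w) auto
    also have "\<dots> \<le> C2 n * E"
      using ratio_le_C2[OF admissible_codes[OF w]] E_pos by (intro mult_right_mono) auto
    finally show ?thesis using n e by auto
  qed
  ultimately show "\<exists>A. open A \<and> w \<in> A \<and> (\<forall>v\<in>codes. v \<in> A \<longrightarrow> code_point v \<in> B)" by blast
qed

text \<open>Open covers of \<open>K\<close> can then be made finite, so that the weights of a single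
  level replace a measure on \<open>K\<close>.\<close>

lemma compact_K: "compact K"
  unfolding K_eq by (rule compact_continuous_image[OF continuous_on_code_point compact_codes])

lemma extend_to_code:
  assumes "v \<in> words T"
  obtains w where "w \<in> codes" "\<And>i. i \<in> {1..T} \<Longrightarrow> w i = v i"
proof
  \<comment> \<open>Letter \<open>1\<close> is available at every level from \<open>1\<close> on;
    index \<open>0\<close> gets the value prescribed by \<open>codes\<close>.\<close>
  let ?w = "\<lambda>i. if i \<in> {1..T} then v i else if i = 0 then 0 else 1"
  have "?w m \<in> {1..N m}" if "1 \<le> m" for m
    using PiE_mem[OF assms[unfolded words_def], of m] two_le_N[OF that] that by auto
  then show "?w \<in> codes" by (simp add: codes_def)
qed simp

text \<open>A word extends to a code, whose point lies in the cylinder. Hence the weight of every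
  cylinder can be charged to some member of a cover of \<open>K\<close>.\<close>

lemma K_meets_cylinder:
  assumes "v \<in> words T"
  shows "K \<inter> word_map v T ` X \<noteq> {}"
proof -
  obtain w where w: "w \<in> codes" "\<And>i. i \<in> {1..T} \<Longrightarrow> w i = v i"
    using extend_to_code[OF assms] by blast
  then have "word_map w T = word_map v T" by (intro word_map_cong) auto
  with code_point_mem[OF w(1), of T] w(1) show ?thesis by (auto simp: K_eq)
qed

lemma K_nonempty: "K \<noteq> {}"
  using K_meets_cylinder[of "\<lambda>_. undefined" 0] by (auto simp: words_def)

lemma K_subset_cylinders: "K \<subseteq> (\<Union>v\<in>words n. word_map v n ` X)"
proof
  fix x assume "x \<in> K"
  then obtain w where w: "w \<in> codes" "x = code_point w" by (auto simp: K_eq)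
  have "restrict w {1..n} \<in> words n" using w by (auto simp: words_def codes_def)
  moreover have "word_map (restrict w {1..n}) n = word_map w n" by (intro word_map_cong) auto
  ultimately show "x \<in> (\<Union>v\<in>words n. word_map v n ` X)"
    using code_point_mem[OF w(1), of n] w(2) by (intro UN_I[of "restrict w {1..n}"]) simp_all
qed

section \<open>Hausdorff measure\<close>

text \<open>Mass distribution principle without a measure: the total weight \<open>1\<close> of one
  deep level is shared among the sets that its cylinders meet, and \<open>weight_meeting_le\<close>
  bounds the share of each set.\<close>

lemma finite_cover_ge:
  assumes s: "0 \<le> s" and b: "0 < b" "\<And>n. n0 \<le> n \<Longrightarrow> b \<le> moran_prod N r n s"
    and I: "finite I" "K \<subseteq> (\<Union>i\<in>I. U i)"
    and \<rho>: "\<And>i. i \<in> I \<Longrightarrow> 0 < \<rho> i" "\<And>i. i \<in> I \<Longrightarrow> \<rho> i < r0 ^ n0"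
    and U: "\<And>i x y. i \<in> I \<Longrightarrow> x \<in> U i \<Longrightarrow> y \<in> U i \<Longrightarrow> dist x y \<le> \<rho> i"
  shows "b \<le> overlap_bound * (\<Sum>i\<in>I. \<rho> i powr s)"
proof -
  \<comment> \<open>Finiteness of \<open>I\<close> gives a single level \<open>T\<close> whose
    ratios are below every \<open>\<rho> i\<close>.\<close>
  have "\<forall>\<^sub>F n in sequentially. \<forall>i\<in>I. C2 n < \<rho> i"
    using \<rho>(1) by (intro eventually_ball_finite I(1) ballI order_tendstoD(2)[OF C2_tendsto])
  then obtain T where T: "\<And>i. i \<in> I \<Longrightarrow> C2 T < \<rho> i"
    by (auto simp: eventually_sequentially)
  have "1 = (\<Sum>v\<in>words T. weight s v T)" by (simp add: sum_weight)
  also have "\<dots> \<le> (\<Sum>v\<in>words T. \<Sum>i\<in>I. if word_map v T ` X \<inter> U i \<noteq> {} then weight s v T else 0)"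
  proof (rule sum_mono)
    fix v assume "v \<in> words T"
    then obtain i where i: "i \<in> I" "word_map v T ` X \<inter> U i \<noteq> {}"
      using K_meets_cylinder I(2) by blast
    then show "weight s v T \<le> (\<Sum>i\<in>I. if word_map v T ` X \<inter> U i \<noteq> {} then weight s v T else 0)"
      using member_le_sum[of i I "\<lambda>i. if word_map v T ` X \<inter> U i \<noteq> {} then weight s v T else 0"]
        I(1) weight_nonneg by simp
  qed
  also have "\<dots> = (\<Sum>i\<in>I. \<Sum>v | v \<in> words T \<and> word_map v T ` X \<inter> U i \<noteq> {}. weight s v T)"
    by (subst sum.swap) (simp only: sum.inter_filter[OF finite_words])
  also have "\<dots> \<le> (\<Sum>i\<in>I. overlap_bound * (\<rho> i powr s / b))"
    by (intro sum_mono weight_meeting_le[OF s b \<rho>(1) \<rho>(2) less_imp_le[OF T] U])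
  also have "\<dots> = overlap_bound * (\<Sum>i\<in>I. \<rho> i powr s) / b"
    by (simp add: sum_distrib_left sum_divide_distrib)
  finally show ?thesis using b(1) by (simp add: field_simps)
qed

abbreviation P :: "nat \<Rightarrow> real \<Rightarrow> real" where
  "P \<equiv> moran_prod N r"

text \<open>The weights of level \<open>n\<close> sum to \<open>1\<close>, and each is a ratio power
  divided by \<open>P n s\<close>.\<close>

lemma sum_ratio_powr: "(\<Sum>v\<in>words n. ratio v n powr s) = P n s"
proof -
  have "(\<Sum>v\<in>words n. ratio v n powr s) / P n s = (\<Sum>v\<in>words n. weight s v n)"
    unfolding sum_divide_distrib by (intro sum.cong) (auto simp: weight_eq admissible_words)
  then show ?thesis using moran_prod_pos[of n s] by (simp add: sum_weight field_simps)
qed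

lemma cylinder_diameter:
  assumes "v \<in> words n"
  shows "bounded (word_map v n ` X)" "diameter (word_map v n ` X) \<le> ratio v n * E"
proof -
  note adm = admissible_words[OF assms]
  show "bounded (word_map v n ` X)"
    using word_map_X_subset[OF adm] compact_imp_bounded[OF compact_X] by (rule bounded_subset[rotated])
  show "diameter (word_map v n ` X) \<le> ratio v n * E"
    using dist_word_map_X[OF adm] a_in_X by (intro diameter_le) (auto simp: dist_norm)
qed

text \<open>The cylinders of level \<open>n\<close> cover \<open>K\<close> with power sum at most
  \<open>E powr s * P n s\<close>. As \<open>P n s \<le> b\<close> for infinitely many
  \<open>n\<close>, some such level also has cylinders smaller than \<delta>.\<close>

lemma hausdorff_measure_K_le:
  assumes s: "0 < s" and b: "\<exists>\<^sub>F n in sequentially. P n s \<le> b"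
  shows "hausdorff_measure s K \<le> ennreal (E powr s * b)"
  unfolding hausdorff_measure_def
proof (rule SUP_least)
  fix \<delta> :: real assume "\<delta> \<in> {0<..}"
  then have "\<forall>\<^sub>F n in sequentially. C2 n * E < \<delta>"
    using tendsto_mult_right[OF C2_tendsto, of E] by (intro order_tendstoD(2)) auto
  then obtain n where n: "P n s \<le> b" "C2 n * E < \<delta>"
    using frequently_ex[OF frequently_eventually_conj[OF b]] by blast
  obtain h where h: "bij_betw h {0..<card (words n)} (words n)"
    using ex_bij_betw_nat_finite[OF finite_words] by blast
  \<comment> \<open>The enumerated cylinders are padded with empty sets, which
    \<open>diam_powr\<close> counts as \<open>0\<close>.\<close>
  let ?U = "\<lambda>i. if i < card (words n) then word_map (h i) n ` X else {}"
  have hw: "h i \<in> words n" if "i < card (words n)" for i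
    using h that by (auto simp: bij_betw_def)
  have "K \<subseteq> (\<Union>i. ?U i)"
  proof
    fix x assume "x \<in> K"
    then obtain v where v: "v \<in> words n" "x \<in> word_map v n ` X" using K_subset_cylinders by blast
    then obtain i where "i < card (words n)" "v = h i" using h by (force simp: bij_betw_def)
    then have "x \<in> ?U i" using v by simp
    then show "x \<in> (\<Union>i. ?U i)" by blast
  qed
  moreover have "bounded (?U i) \<and> diameter (?U i) \<le> \<delta>" for i
  proof (cases "i < card (words n)")
    case True
    note cyl = cylinder_diameter[OF hw[OF True]]
    have "ratio (h i) n * E \<le> C2 n * E"
      using ratio_le_C2[OF admissible_words[OF hw[OF True]]] E_pos by (intro mult_right_mono) auto
    with n cyl True show ?thesis by auto
  qed (use \<open>\<delta> \<in> {0<..}\<close> in auto)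
  ultimately have "?U \<in> delta_covers \<delta> K" unfolding delta_covers_def by blast
  then have "hausdorff_premeasure s \<delta> K \<le> (\<Sum>i. diam_powr s (?U i))"
    unfolding hausdorff_premeasure_def by (rule INF_lower)
  also have "\<dots> = (\<Sum>i\<in>{0..<card (words n)}. diam_powr s (?U i))"
    by (rule suminf_finite) (auto simp: diam_powr_def)
  also have "\<dots> = (\<Sum>i\<in>{0..<card (words n)}. diam_powr s (word_map (h i) n ` X))"
    by (rule sum.cong) auto
  also have "\<dots> = (\<Sum>v\<in>words n. diam_powr s (word_map v n ` X))"
    by (rule sum.reindex_bij_betw[OF h])
  also have "\<dots> \<le> (\<Sum>v\<in>words n. ennreal (ratio v n powr s * E powr s))"
  proof (rule sum_mono)
    fix v assume v: "v \<in> words n"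
    have "diameter (word_map v n ` X) powr s \<le> (ratio v n * E) powr s"
      using s cylinder_diameter[OF v] by (intro powr_mono2 diameter_ge_0) auto
    also have "\<dots> = ratio v n powr s * E powr s"
      using E_pos ratio_pos[OF admissible_words[OF v]] by (simp add: powr_mult)
    finally show "diam_powr s (word_map v n ` X) \<le> ennreal (ratio v n powr s * E powr s)"
      using s by (simp add: diam_powr_pos ennreal_leI)
  qed
  also have "\<dots> = ennreal ((\<Sum>v\<in>words n. ratio v n powr s) * E powr s)"
    unfolding sum_distrib_right by (rule sum_ennreal) simp
  also have "\<dots> = ennreal (E powr s * P n s)"
    by (simp add: sum_ratio_powr mult.commute)
  also have "\<dots> \<le> ennreal (E powr s * b)"
    using n by (intro ennreal_leI mult_left_mono) auto
  finally show "hausdorff_premeasure s \<delta> K \<le> ennreal (E powr s * b)" .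
qed

text \<open>A countable cover is thickened to open sets at total cost \<open>e\<close>; compactness
  leaves finitely many of them, to which \<open>finite_cover_ge\<close> applies.\<close>

lemma hausdorff_measure_K_ge:
  assumes s: "0 < s" and b: "0 < b" "\<forall>\<^sub>F n in sequentially. b \<le> P n s"
  shows "ennreal (b / overlap_bound) \<le> hausdorff_measure s K"
proof -
  obtain n0 where n0: "\<And>n. n0 \<le> n \<Longrightarrow> b \<le> P n s"
    using b(2) by (auto simp: eventually_sequentially)
  \<comment> \<open>Half of \<open>r0 ^ n0\<close> leaves room for enlarged scales that still lie
    below \<open>r0 ^ n0\<close>.\<close>
  define \<delta> where "\<delta> = r0 ^ n0 / 2"
  have \<delta>: "0 < \<delta>" "\<delta> < r0 ^ n0" using r0_pos by (auto simp: \<delta>_def)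
  have "ennreal (b / overlap_bound) \<le> hausdorff_premeasure s \<delta> K"
    unfolding hausdorff_premeasure_def
  proof (rule INF_greatest, rule ennreal_le_epsilon)
    fix U and e :: real
    assume U: "U \<in> delta_covers \<delta> K" and e: "0 < e"
    let ?D = "\<lambda>i. diameter (U i)"
    have Ub: "bounded (U i)" "?D i \<le> \<delta>" for i using U by (auto simp: delta_covers_def)
    \<comment> \<open>The errors sum to \<open>e\<close> over all \<open>i\<close>; strictness makes
      the scale positive even for sets of diameter \<open>0\<close>.\<close>
    have "\<exists>x. ?D i < x \<and> x < r0 ^ n0 \<and> x powr s \<le> ?D i powr s + e * (1/2) ^ Suc i" for i
    proof -
      have "?D i < r0 ^ n0" using Ub(2)[of i] \<delta> by linarith
      from powr_upper_approx[OF s diameter_ge_0[OF Ub(1)] this, of "e * (1/2) ^ Suc i"] e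
      show ?thesis by auto
    qed
    then obtain \<rho> where \<rho>: "\<And>i. ?D i < \<rho> i" "\<And>i. \<rho> i < r0 ^ n0"
        "\<And>i. \<rho> i powr s \<le> ?D i powr s + e * (1/2) ^ Suc i"
      by metis
    \<comment> \<open>Each of two points moves by less than half the slack, so
      \<open>\<rho> i\<close> still bounds their distance.\<close>
    define G where "G i = (\<Union>y\<in>U i. ball y ((\<rho> i - ?D i) / 2))" for i
    have G_le: "dist x y \<le> \<rho> i" if "x \<in> G i" "y \<in> G i" for i x y
    proof -
      obtain x' y' where *: "x' \<in> U i" "y' \<in> U i" "dist x' x < (\<rho> i - ?D i) / 2"
          "dist y' y < (\<rho> i - ?D i) / 2"
        using \<open>x \<in> G i\<close> \<open>y \<in> G i\<close> by (auto simp: G_def)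
      have "dist x y \<le> dist x' x + dist x' y' + dist y' y"
        using dist_triangle[of x y x'] dist_triangle[of x' y y'] by (simp add: dist_commute)
      with * diameter_bounded_bound[OF Ub(1), of x' i y'] show ?thesis
        by (simp add: field_simps)
    qed
    have "U i \<subseteq> G i" for i using \<rho>(1)[of i] by (force simp: G_def)
    then have cover: "K \<subseteq> (\<Union>i\<in>UNIV. G i)" using U unfolding delta_covers_def by blast
    have open_G: "open (G i)" if "i \<in> UNIV" for i by (auto simp: G_def)
    obtain I where I: "I \<subseteq> UNIV" "finite I" "K \<subseteq> (\<Union>i\<in>I. G i)"
      by (rule compactE_image[OF compact_K open_G cover])
    have \<rho>_pos: "0 < \<rho> i" for i using \<rho>(1)[of i] diameter_ge_0[OF Ub(1), of i] by linarith
    have "b \<le> overlap_bound * (\<Sum>i\<in>I. \<rho> i powr s)"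
      using s n0 by (intro finite_cover_ge[OF _ b(1) _ I(2,3) \<rho>_pos \<rho>(2) G_le]) auto
    then have "b / overlap_bound \<le> (\<Sum>i\<in>I. \<rho> i powr s)"
      using overlap_bound_pos by (simp add: field_simps)
    also have "\<dots> \<le> (\<Sum>i\<in>I. ?D i powr s) + e * (\<Sum>i\<in>I. (1/2) ^ Suc i)"
      using sum_mono[of I, OF \<rho>(3)] by (simp add: sum.distrib sum_distrib_left)
    also have "\<dots> \<le> (\<Sum>i\<in>I. ?D i powr s) + e * 1"
    proof -
      have "(\<Sum>i\<in>I. (1/2) ^ Suc i) \<le> (\<Sum>i. (1/2::real) ^ Suc i)"
        by (intro sum_le_suminf I sums_summable[OF power_half_series]) auto
      then have "(\<Sum>i\<in>I. (1/2::real) ^ Suc i) \<le> 1"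
        using sums_unique[OF power_half_series] by simp
      then show ?thesis using e by (intro add_left_mono mult_left_mono) auto
    qed
    finally have "ennreal (b / overlap_bound) \<le> ennreal ((\<Sum>i\<in>I. ?D i powr s) + e)"
      by (intro ennreal_leI) simp
    also have "\<dots> = (\<Sum>i\<in>I. diam_powr s (U i)) + ennreal e"
      using e s by (simp add: ennreal_plus sum_nonneg diam_powr_pos)
    also have "\<dots> \<le> (\<Sum>i. diam_powr s (U i)) + ennreal e"
      using I by (intro add_right_mono sum_le_suminf) auto
    finally show "ennreal (b / overlap_bound) \<le> (\<Sum>i. diam_powr s (U i)) + ennreal e" .
  qed
  also have "\<dots> \<le> hausdorff_measure s K"
    unfolding hausdorff_measure_def using \<delta> by (intro SUP_upper) auto
  finally show ?thesis .
qed

section \<open>Moran exponents and dimensions\<close>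

lemma C2_less_1:
  assumes "1 \<le> n"
  shows "C2 n < 1"
proof -
  have "C2 n < (\<Prod>i=1..n. 1)"
    unfolding C2_def
    using assms less_imp_le[OF c2_pos] less_imp_le[OF c2_less_1] c2_less_1[of 1]
    by (intro prod_mono_strict[of 1]) auto
  then show ?thesis by simp
qed

lemma C2_powr_tendsto: "0 < t \<Longrightarrow> (\<lambda>n. C2 n powr t) \<longlonglongrightarrow> 0"
  using tendsto_powr'[OF C2_tendsto tendsto_const[of t]] less_imp_le[OF C2_pos] by auto

text \<open>Termwise, \<open>r i j powr t \<le> c2 i powr t\<close>. Since \<open>C2\<close> tends
  to \<open>0\<close>, this drives every comparison of different exponents.\<close>

lemma moran_prod_add_le:
  assumes "0 \<le> t"
  shows "P n (s + t) \<le> P n s * C2 n powr t"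
proof -
  have "P n (s + t) \<le> (\<Prod>i=1..n. (\<Sum>j=1..N i. r i j powr s) * c2 i powr t)"
    unfolding moran_prod_def
  proof (rule prod_mono, intro conjI)
    fix i assume i: "i \<in> {1..n}"
    show "0 \<le> (\<Sum>j=1..N i. r i j powr (s + t))" by (intro sum_nonneg) auto
    have "(\<Sum>j=1..N i. r i j powr (s + t)) \<le> (\<Sum>j=1..N i. r i j powr s * c2 i powr t)"
    proof (rule sum_mono)
      fix j assume j: "j \<in> {1..N i}"
      then have "r i j powr t \<le> c2 i powr t"
        using i assms r_le_c2[of i j] r_pos[of i j] by (intro powr_mono2) auto
      then show "r i j powr (s + t) \<le> r i j powr s * c2 i powr t"
        by (simp add: powr_add mult_left_mono)
    qed
    then show "(\<Sum>j=1..N i. r i j powr (s + t)) \<le> (\<Sum>j=1..N i. r i j powr s) * c2 i powr t"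
      by (simp add: sum_distrib_right)
  qed
  also have "\<dots> = P n s * C2 n powr t"
    unfolding prod.distrib moran_prod_def C2_def
    by (subst prod_powr_distrib) (auto intro: less_imp_le c2_pos)
  finally show ?thesis .
qed

lemma moran_prod_strict_antimono:
  assumes "1 \<le> n" "s < t"
  shows "P n t < P n s"
proof -
  have "C2 n powr (t - s) < 1"
    using C2_less_1[OF assms(1)] C2_pos[of n] assms(2)
    using powr_less_mono2[of "t - s" "C2 n" 1] by simp
  then have "P n s * C2 n powr (t - s) < P n s * 1"
    using moran_prod_pos by (intro mult_strict_left_mono)
  with moran_prod_add_le[of "t - s" n s] assms(2) show ?thesis by simp
qed

text \<open>Existence by the intermediate value theorem, uniqueness by strict monotonicity; level
  \<open>0\<close> is excluded because \<open>P 0\<close> is constantly \<open>1\<close>.\<close>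

lemma moran_prod_exponent:
  assumes "1 \<le> n"
  shows "P n (moran_exponent N r n) = 1"
proof -
  have P0: "1 \<le> P n 0"
    unfolding moran_prod_def
  proof (rule prod_ge_1)
    fix i assume i: "i \<in> {1..n}"
    have "(\<Sum>j=1..N i. r i j powr 0) = (\<Sum>j=1..N i. 1)"
      using i r_pos[of i] by (intro sum.cong) (auto dest: less_imp_neq[symmetric])
    with two_le_N[of i] i show "1 \<le> (\<Sum>j=1..N i. r i j powr 0)" by simp
  qed
  \<comment> \<open>Chosen so that \<open>C2 n powr t = 1 / P n 0\<close>, which brings
    \<open>P n t\<close> down to at most \<open>1\<close>.\<close>
  define t where "t = - ln (P n 0) / ln (C2 n)"
  have ln_C2: "ln (C2 n) < 0" using C2_less_1[OF assms] C2_pos[of n] by simp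
  have t: "0 \<le> t" using P0 ln_C2 by (simp add: t_def divide_nonneg_neg)
  have "C2 n powr t = exp (- ln (P n 0))"
    using C2_pos[of n] ln_C2 by (simp add: powr_def t_def)
  also have "\<dots> = 1 / P n 0" using P0 by (simp add: exp_minus inverse_eq_divide)
  finally have "P n t \<le> 1" using moran_prod_add_le[OF t, of n 0] P0 by simp
  moreover have "continuous_on {0..t} (P n)"
    unfolding moran_prod_def
    using r_pos by (intro continuous_intros) (fastforce dest: less_imp_neq)
  ultimately obtain x where x: "P n x = 1"
    using IVT2'[of "P n" t 1 0] P0 t by auto
  show ?thesis
    unfolding moran_exponent_def
  proof (rule theI[of "\<lambda>s. P n s = 1", OF x])
    fix y assume "P n y = 1"
    then show "y = x"
      using x moran_prod_strict_antimono[OF assms, of x y] moran_prod_strict_antimono[OF assms, of y x]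
      by (cases x y rule: linorder_cases) auto
  qed
qed

lemma moran_prod_le_1_iff:
  assumes "1 \<le> n"
  shows "P n s \<le> 1 \<longleftrightarrow> moran_exponent N r n \<le> s"
  using moran_prod_strict_antimono[OF assms, of s "moran_exponent N r n"]
    moran_prod_strict_antimono[OF assms, of "moran_exponent N r n" s] moran_prod_exponent[OF assms]
  by (cases s "moran_exponent N r n" rule: linorder_cases) auto

text \<open>At this exponent the power of \<open>r0\<close> is \<open>1 / 2\<close>, and every level
  has at least two maps, so each factor of \<open>P n\<close> is at least \<open>1\<close>. The
  bound keeps the liminf positive.\<close>

lemma moran_exponent_ge:
  assumes "1 \<le> n"
  shows "ln 2 / - ln r0 \<le> moran_exponent N r n"
proof (rule ccontr)
  let ?s = "ln 2 / - ln r0"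
  assume "\<not> ?thesis"
  then have "P n ?s < 1"
    using moran_prod_strict_antimono[OF assms, of "moran_exponent N r n" ?s]
      moran_prod_exponent[OF assms] by simp
  moreover have "1 \<le> P n ?s"
    unfolding moran_prod_def
  proof (rule prod_ge_1)
    fix i assume i: "i \<in> {1..n}"
    have ln_r0: "ln r0 < 0" using r0_pos r0_less_1 by simp
    have "r0 powr ?s = exp (- ln 2)" using r0_pos ln_r0 by (simp add: powr_def)
    then have r0_s: "r0 powr ?s = 1 / 2" by (simp add: exp_minus)
    have "1 \<le> (\<Sum>j=1..N i. r0 powr ?s)"
      unfolding r0_s using two_le_N[of i] i by simp
    also have "\<dots> \<le> (\<Sum>j=1..N i. r i j powr ?s)"
      using i r0_le r0_pos ln_r0 by (intro sum_mono powr_mono2) (auto simp: divide_nonneg_neg)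
    finally show "1 \<le> (\<Sum>j=1..N i. r i j powr ?s)" .
  qed
  ultimately show False by simp
qed

text \<open>The images of \<open>V (Suc n)\<close> under the words of length \<open>n\<close> are
  disjoint subsets of \<open>X\<close>, with volumes at least \<open>v0\<close> times the
  \<open>CARD('d)\<close>-th powers of the ratios.\<close>

lemma moran_prod_dim_le: "P n (real CARD('d)) \<le> measure lebesgue X / v0"
proof -
  let ?A = "\<lambda>w. word_map w n ` V (Suc n)"
  have "P n (real CARD('d)) * v0 = (\<Sum>w\<in>words n. ratio w n ^ CARD('d) * v0)"
    unfolding sum_ratio_powr[symmetric] sum_distrib_right
    by (intro sum.cong) (auto simp: powr_realpow ratio_pos admissible_words)
  also have "\<dots> \<le> (\<Sum>w\<in>words n. measure lebesgue (?A w))"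
    by (intro sum_mono word_map_V(2) admissible_words)
  also have "\<dots> = measure lebesgue (\<Union>w\<in>words n. ?A w)"
  proof (rule measure_UNION'[symmetric, OF finite_words])
    show "pairwise (\<lambda>i j. disjnt (?A i) (?A j)) (words n)"
    proof (rule pairwiseI)
      fix u v assume uv: "u \<in> words n" "v \<in> words n" "u \<noteq> v"
      then obtain i where "i \<in> {1..n}" "u i \<noteq> v i"
        unfolding words_def by (meson PiE_ext)
      with uv show "disjnt (?A u) (?A v)"
        using disjoint_word_map_V[of u n v n i] by (auto simp: disjnt_def admissible_words)
    qed
  qed (auto intro: word_map_V(1) admissible_words)
  also have "\<dots> \<le> measure lebesgue X"
  proof (rule measure_mono_fmeasurable)
    show "(\<Union>w\<in>words n. ?A w) \<subseteq> X"
      using word_map_X_subset[OF admissible_words] V_subset[of "Suc n"] by force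
    show "(\<Union>w\<in>words n. ?A w) \<in> sets lebesgue"
      using finite_words word_map_V(1)[OF admissible_words]
      by (intro sets.finite_UN) (auto dest: fmeasurableD)
    show "X \<in> lmeasurable" using compact_X by (rule lmeasurable_compact)
  qed
  finally show ?thesis using v0_pos by (simp add: field_simps)
qed

text \<open>One unit above the dimension, the extra factor \<open>C2 n\<close> tends to
  \<open>0\<close> and beats the constant of \<open>moran_prod_dim_le\<close>. This makes the liminf
  finite.\<close>

lemma eventually_moran_exponent_le:
  "\<forall>\<^sub>F n in sequentially. moran_exponent N r n \<le> real CARD('d) + 1"
proof -
  have "(\<lambda>n. measure lebesgue X / v0 * C2 n powr 1) \<longlonglongrightarrow> measure lebesgue X / v0 * 0"
    by (intro tendsto_mult_left C2_powr_tendsto) simp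
  then have "\<forall>\<^sub>F n in sequentially. measure lebesgue X / v0 * C2 n powr 1 < 1"
    by (intro order_tendstoD(2)) auto
  then show ?thesis
    using eventually_ge_at_top[of 1]
  proof eventually_elim
    case (elim n)
    have "P n (real CARD('d) + 1) \<le> P n (real CARD('d)) * C2 n powr 1"
      by (rule moran_prod_add_le) simp
    also have "\<dots> \<le> measure lebesgue X / v0 * C2 n powr 1"
      by (intro mult_right_mono moran_prod_dim_le) simp
    finally show ?case using elim moran_prod_le_1_iff[of n "real CARD('d) + 1"] by linarith
  qed
qed

text \<open>A positive finite value makes \<open>real_of_ereal\<close> faithful and the estimates
  for \<open>0 < s\<close> applicable.\<close>

lemma moran_liminf_real:
  obtains s where "0 < s" "liminf (\<lambda>n. ereal (moran_exponent N r n)) = ereal s"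
proof -
  let ?L = "liminf (\<lambda>n. ereal (moran_exponent N r n))"
  have "ereal (ln 2 / - ln r0) \<le> ?L"
    using moran_exponent_ge by (intro Liminf_bounded) (auto simp: eventually_sequentially)
  moreover have "0 < ln 2 / - ln r0" using r0_pos r0_less_1 by (intro divide_pos_pos) auto
  moreover have "?L \<le> limsup (\<lambda>n. ereal (moran_exponent N r n))" by (intro Liminf_le_Limsup) simp
  moreover have "\<dots> \<le> ereal (real CARD('d) + 1)"
    using eventually_moran_exponent_le by (intro Limsup_bounded) simp
  ultimately show ?thesis
    using that by (cases ?L) (auto intro: less_le_trans)
qed

text \<open>For \<open>t\<close> strictly between \<open>s\<close> and the liminf, eventually
  \<open>1 \<le> P n t \<le> P n s * C2 n powr (t - s)\<close>, and the last factor tends to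
  \<open>0\<close>.\<close>

lemma eventually_moran_prod_ge:
  assumes s: "ereal s < liminf (\<lambda>n. ereal (moran_exponent N r n))" and b: "0 < b"
  shows "\<forall>\<^sub>F n in sequentially. b \<le> P n s"
proof -
  obtain t where t: "ereal s < ereal t" "ereal t < liminf (\<lambda>n. ereal (moran_exponent N r n))"
    using ereal_dense2[OF s] by blast
  have "\<forall>\<^sub>F n in sequentially. C2 n powr (t - s) < 1 / b"
    using b t(1) by (intro order_tendstoD(2)[OF C2_powr_tendsto]) auto
  with less_LiminfD[OF t(2)] eventually_ge_at_top[of 1] show ?thesis
  proof eventually_elim
    case (elim n)
    have "1 \<le> P n t" using elim moran_prod_le_1_iff[of n t] by auto
    also have "\<dots> \<le> P n s * C2 n powr (t - s)" using moran_prod_add_le[of "t - s" n s] t(1) by simp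
    also have "\<dots> \<le> P n s * (1 / b)"
      using elim moran_prod_pos[of n s] by (intro mult_left_mono) auto
    finally show ?case using b by (simp add: field_simps)
  qed
qed

lemma frequently_moran_exponent_less:
  assumes "liminf (\<lambda>n. ereal (moran_exponent N r n)) < ereal s"
  shows "\<exists>\<^sub>F n in sequentially. moran_exponent N r n < s"
proof (rule ccontr)
  assume "\<not> ?thesis"
  then have "\<forall>\<^sub>F n in sequentially. ereal s \<le> ereal (moran_exponent N r n)"
    by (auto simp: frequently_def not_less elim: eventually_mono)
  then have "ereal s \<le> liminf (\<lambda>n. ereal (moran_exponent N r n))" by (rule Liminf_bounded)
  with assms show False by simp
qed

text \<open>For \<open>t\<close> strictly between the liminf and \<open>s\<close>, infinitely many
  \<open>n\<close> have \<open>P n t \<le> 1\<close>, and the factor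
  \<open>C2 n powr (s - t)\<close> then makes \<open>P n s\<close> small.\<close>

lemma frequently_moran_prod_le:
  assumes s: "liminf (\<lambda>n. ereal (moran_exponent N r n)) < ereal s" and b: "0 < b"
  shows "\<exists>\<^sub>F n in sequentially. P n s \<le> b"
proof -
  obtain t where t: "liminf (\<lambda>n. ereal (moran_exponent N r n)) < ereal t" "ereal t < ereal s"
    using ereal_dense2[OF s] by blast
  have "\<forall>\<^sub>F n in sequentially. C2 n powr (s - t) < b \<and> 1 \<le> n"
    using b t(2) by (intro eventually_conj order_tendstoD(2)[OF C2_powr_tendsto]
        eventually_ge_at_top) auto
  note frequently_eventually_conj[OF frequently_moran_exponent_less[OF t(1)] this]
  then show ?thesis
  proof (rule frequently_elim1)
    fix n assume n: "(C2 n powr (s - t) < b \<and> 1 \<le> n) \<and> moran_exponent N r n < t"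
    have "P n s \<le> P n t * C2 n powr (s - t)" using moran_prod_add_le[of "s - t" n t] t(2) by simp
    also have "\<dots> \<le> 1 * C2 n powr (s - t)"
      using n moran_prod_le_1_iff[of n t] by (intro mult_right_mono) auto
    finally show "P n s \<le> b" using n by simp
  qed
qed

section \<open>The Hausdorff dimension of \<open>K\<close>\<close>

lemma hausdorff_measure_K_eq_0:
  assumes "0 < s" "\<And>b. 0 < b \<Longrightarrow> \<exists>\<^sub>F n in sequentially. P n s \<le> b"
  shows "hausdorff_measure s K = 0"
proof -
  have "hausdorff_measure s K \<le> 0 + ennreal e" if "0 < e" for e
  proof -
    \<comment> \<open>This value of \<open>b\<close> cancels the constant \<open>E powr s\<close> of
      \<open>hausdorff_measure_K_le\<close>.\<close>
    have "0 < e / E powr s" using that E_pos by simp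
    from hausdorff_measure_K_le[OF assms(1) assms(2)[OF this]] show ?thesis
      using E_pos by simp
  qed
  then have "hausdorff_measure s K \<le> 0" by (rule ennreal_le_epsilon)
  then show ?thesis by simp
qed

text \<open>Above the liminf the measure vanishes, as \<open>P n s\<close> gets arbitrarily small
  infinitely often; below it the measure is positive, as \<open>P n s\<close> is eventually at least
  \<open>1\<close>.\<close>

lemma hausdorff_dim_K: "hausdorff_dim K = liminf (\<lambda>n. ereal (moran_exponent N r n))"
proof -
  let ?L = "liminf (\<lambda>n. ereal (moran_exponent N r n))"
  obtain s0 where s0: "0 < s0" "?L = ereal s0" by (rule moran_liminf_real)
  show ?thesis
    unfolding hausdorff_dim_def
  proof (rule antisym)
    show "Inf {ereal s |s. 0 \<le> s \<and> hausdorff_measure s K = 0} \<le> ?L"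
    proof (rule dense_ge)
      fix y assume y: "?L < y"
      show "Inf {ereal s |s. 0 \<le> s \<and> hausdorff_measure s K = 0} \<le> y"
      proof (cases y)
        case (real s)
        then have "hausdorff_measure s K = 0" "0 \<le> s"
          using y s0 by (auto intro!: hausdorff_measure_K_eq_0 frequently_moran_prod_le)
        with real show ?thesis by (intro Inf_lower) auto
      qed (use y s0 in auto)
    qed
    show "?L \<le> Inf {ereal s |s. 0 \<le> s \<and> hausdorff_measure s K = 0}"
    proof (rule Inf_greatest, rule ccontr)
      fix y assume "y \<in> {ereal s |s. 0 \<le> s \<and> hausdorff_measure s K = 0}" "\<not> ?L \<le> y"
      then obtain s where s: "0 \<le> s" "hausdorff_measure s K = 0" "ereal s < ?L" by auto
      show False
      proof (cases "s = 0")
        case True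
        with s hausdorff_measure_0_ge_1[OF K_nonempty] show False by simp
      next
        case False
        then have "ennreal (1 / overlap_bound) \<le> hausdorff_measure s K"
          using s by (intro hausdorff_measure_K_ge eventually_moran_prod_ge) auto
        with s overlap_bound_pos show False by simp
      qed
    qed
  qed
qed

section \<open>Comparison with the lower box dimension\<close>

lemma C2_E_tendsto: "(\<lambda>n. C2 n * E) \<longlonglongrightarrow> 0"
  using tendsto_mult_right[OF C2_tendsto, of E] by simp

text \<open>Cylinders of a deep level form a finite cover, so the \<open>LEAST\<close> in
  \<open>covering_number\<close> is taken over a nonempty set.\<close>

lemma covering_number_K_attained:
  assumes "0 < \<delta>"
  obtains C where "finite C" "card C = covering_number \<delta> K" "K \<subseteq> \<Union>C"
    "\<And>U. U \<in> C \<Longrightarrow> bounded U \<and> diameter U \<le> \<delta>"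
proof -
  let ?cover = "\<lambda>m C. finite C \<and> card C = m \<and> K \<subseteq> \<Union>C \<and> (\<forall>U\<in>C. bounded U \<and> diameter U \<le> \<delta>)"
  have "\<forall>\<^sub>F n in sequentially. C2 n * E < \<delta>"
    using assms by (intro order_tendstoD(2)[OF C2_E_tendsto])
  then obtain n where n: "C2 n * E < \<delta>" by (auto simp: eventually_sequentially)
  have "bounded (word_map v n ` X) \<and> diameter (word_map v n ` X) \<le> \<delta>" if "v \<in> words n" for v
  proof -
    have "ratio v n * E \<le> C2 n * E"
      using ratio_le_C2[OF admissible_words[OF that]] E_pos by (intro mult_right_mono) auto
    with n cylinder_diameter[OF that] show ?thesis by auto
  qed
  then have "?cover (card ((\<lambda>v. word_map v n ` X) ` words n)) ((\<lambda>v. word_map v n ` X) ` words n)"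
    using K_subset_cylinders[of n] finite_words by auto
  then have "\<exists>m C. ?cover m C" by blast
  then have "\<exists>C. ?cover (covering_number \<delta> K) C"
    unfolding covering_number_def by (rule LeastI_ex)
  then show ?thesis using that by blast
qed

text \<open>With the common scale \<delta>, \<open>finite_cover_ge\<close> bounds
  \<open>covering_number \<delta> K * \<delta> powr s\<close> below by
  \<open>1 / overlap_bound\<close>, for every positive \<open>s\<close> below the liminf; then take
  logarithms.\<close>

lemma hausdorff_dim_K_le_lower_box_dim: "hausdorff_dim K \<le> lower_box_dim K"
proof -
  obtain s0 where s0: "0 < s0" "liminf (\<lambda>n. ereal (moran_exponent N r n)) = ereal s0"
    by (rule moran_liminf_real)
  have le: "ereal s \<le> lower_box_dim K" if s: "0 < s" "s < s0" for s
  proof -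
    have "\<forall>\<^sub>F n in sequentially. 1 \<le> P n s"
      using s s0 by (intro eventually_moran_prod_ge) auto
    then obtain n0 where n0: "\<And>n. n0 \<le> n \<Longrightarrow> 1 \<le> P n s" by (auto simp: eventually_sequentially)
    have "\<forall>\<^sub>F \<delta> in at_right 0. \<delta> < r0 ^ n0"
      using r0_pos by (intro order_tendstoD(2)[OF tendsto_ident_at]) auto
    moreover have "\<forall>\<^sub>F \<delta> in at_right 0. \<delta> < (1::real)"
      by (intro order_tendstoD(2)[OF tendsto_ident_at]) auto
    moreover have "\<forall>\<^sub>F \<delta> in at_right 0. 0 < (\<delta>::real)" by (simp add: eventually_at_filter)
    ultimately have ev: "\<forall>\<^sub>F \<delta> in at_right 0. ereal (s - ln overlap_bound / - ln \<delta>)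
        \<le> ereal (ln (real (covering_number \<delta> K)) / - ln \<delta>)"
    proof eventually_elim
      case (elim \<delta>)
      obtain C where C: "finite C" "card C = covering_number \<delta> K" "K \<subseteq> \<Union>C"
          "\<And>U. U \<in> C \<Longrightarrow> bounded U \<and> diameter U \<le> \<delta>"
        using covering_number_K_attained[OF elim(3)] by blast
      have dist: "dist x y \<le> \<delta>" if "U \<in> C" "x \<in> U" "y \<in> U" for U x y
        using diameter_bounded_bound[of U x y] C(4)[OF that(1)] that by simp
      have "1 \<le> overlap_bound * (\<Sum>U\<in>C. \<delta> powr s)"
        by (rule finite_cover_ge[of s 1 n0 C "\<lambda>U. U"]) (use s n0 C elim dist in auto)
      then have 1: "1 \<le> overlap_bound * (real (covering_number \<delta> K) * \<delta> powr s)"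
        by (simp add: C(2))
      then have "covering_number \<delta> K \<noteq> 0" by (intro notI) simp
      then have "ln (overlap_bound * (real (covering_number \<delta> K) * \<delta> powr s))
          = ln overlap_bound + ln (real (covering_number \<delta> K)) + s * ln \<delta>"
        using overlap_bound_pos elim by (simp add: ln_mult ln_powr)
      moreover have "0 \<le> ln (overlap_bound * (real (covering_number \<delta> K) * \<delta> powr s))"
        using 1 by (rule ln_ge_zero)
      ultimately have "s * - ln \<delta> - ln overlap_bound \<le> ln (real (covering_number \<delta> K))" by simp
      then have "(s * - ln \<delta> - ln overlap_bound) / - ln \<delta> \<le> ln (real (covering_number \<delta> K)) / - ln \<delta>"
        using elim by (intro divide_right_mono) auto
      then show ?case using elim by (simp add: diff_divide_distrib)
    qed
    have "filterlim (\<lambda>\<delta>::real. - ln \<delta>) at_top (at_right 0)"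
      using ln_at_0 by (simp add: filterlim_uminus_at_top)
    then have "((\<lambda>\<delta>. s - ln overlap_bound / - ln \<delta>) \<longlongrightarrow> s - 0) (at_right 0)"
      by (intro tendsto_diff tendsto_const real_tendsto_divide_at_top[OF tendsto_const])
    then have "((\<lambda>\<delta>. ereal (s - ln overlap_bound / - ln \<delta>)) \<longlongrightarrow> ereal s) (at_right 0)"
      by (intro tendsto_ereal) simp
    then have "ereal s = Liminf (at_right 0) (\<lambda>\<delta>. ereal (s - ln overlap_bound / - ln \<delta>))"
      by (intro lim_imp_Liminf[symmetric]) (simp_all add: trivial_limit_at_right_real)
    also have "\<dots> \<le> lower_box_dim K"
      unfolding lower_box_dim_def by (rule Liminf_mono[OF ev])
    finally show ?thesis .
  qed
  have "y \<le> lower_box_dim K" if y: "y < ereal s0" for y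
  proof (cases y)
    case (real t)
    \<comment> \<open>\<open>t\<close> may fail to be positive; raising it to at least
      \<open>s0 / 2\<close> makes \<open>le\<close> applicable.\<close>
    then have "ereal t \<le> ereal (max t (s0 / 2))" by simp
    also have "\<dots> \<le> lower_box_dim K" using s0 y real by (intro le) auto
    finally show ?thesis using real by simp
  qed (use y in auto)
  then show ?thesis unfolding hausdorff_dim_K s0(2) by (rule dense_le)
qed

text \<open>All cylinders of level \<open>n\<close> share the ratio \<open>R n\<close>, so at scale
  \<open>R n * E\<close> the covering number is at most
  \<open>card (words n) = P n s / R n powr s\<close>. For \<open>s\<close> above the liminf,
  \<open>P n s \<le> 1\<close> for infinitely many \<open>n\<close>.\<close>

lemma lower_box_dim_le_hausdorff_dim_K:
  assumes hom: "\<And>n j. 1 \<le> n \<Longrightarrow> j \<in> {1..N n} \<Longrightarrow> r n j = \<sigma> n"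
  shows "lower_box_dim K \<le> hausdorff_dim K"
proof -
  obtain s0 where s0: "0 < s0" "liminf (\<lambda>n. ereal (moran_exponent N r n)) = ereal s0"
    by (rule moran_liminf_real)
  define R where "R n = (\<Prod>i=1..n. \<sigma> i)" for n
  have ratio: "ratio v n = R n" if "v \<in> words n" for v n
    unfolding ratio_def R_def using admissible_words[OF that]
    by (intro prod.cong) (auto simp: admissible_def hom)
  have R_pos: "0 < R n" for n
    unfolding R_def
  proof (rule prod_pos)
    fix i assume i: "i \<in> {1..n}"
    then show "0 < \<sigma> i" using r_pos[of i 1] hom[of i 1] two_le_N[of i] by simp
  qed
  have R_le: "R n \<le> C2 n" for n
  proof -
    obtain v where "v \<in> words n" using K_nonempty K_subset_cylinders[of n] by blast
    with ratio ratio_le_C2[OF admissible_words] show ?thesis by metis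
  qed
  have "(\<lambda>n. R n * E) \<longlonglongrightarrow> 0"
  proof (rule tendsto_sandwich[OF _ _ tendsto_const C2_E_tendsto])
    show "\<forall>\<^sub>F n in sequentially. 0 \<le> R n * E"
      using R_pos E_pos by (simp add: less_imp_le)
    show "\<forall>\<^sub>F n in sequentially. R n * E \<le> C2 n * E"
      using R_le E_pos by simp
  qed
  then have lim: "filterlim (\<lambda>n. R n * E) (at_right 0) sequentially"
    using R_pos less_imp_neq[OF R_pos, symmetric] E_pos by (simp add: filterlim_at)
  have "R \<longlonglongrightarrow> 0"
  proof (rule tendsto_sandwich[OF _ _ tendsto_const C2_tendsto])
    show "\<forall>\<^sub>F n in sequentially. 0 \<le> R n" using R_pos by (simp add: less_imp_le)
    show "\<forall>\<^sub>F n in sequentially. R n \<le> C2 n" using R_le by simp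
  qed
  then have "filterlim R (at_right 0) sequentially"
    using R_pos less_imp_neq[OF R_pos, symmetric] by (simp add: filterlim_at)
  then have ln_R: "filterlim (\<lambda>n. - ln (R n)) at_top sequentially"
    using filterlim_compose[OF ln_at_0] by (simp add: filterlim_uminus_at_top)
  have "lower_box_dim K \<le> y" if y: "ereal s0 < y" for y
  proof (rule ccontr)
    assume neg: "\<not> lower_box_dim K \<le> y"
    then obtain t where t: "y = ereal t" using y by (cases y) auto
    then obtain s where s: "s0 < s" "s < t" using y dense[of s0 t] by auto
    have "\<forall>\<^sub>F \<delta> in at_right 0. ereal t < ereal (ln (real (covering_number \<delta> K)) / - ln \<delta>)"
      using neg t unfolding lower_box_dim_def by (intro less_LiminfD) auto
    then have "\<forall>\<^sub>F n in sequentially.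
        ereal t < ereal (ln (real (covering_number (R n * E) K)) / - ln (R n * E))"
      using lim by (rule eventually_compose_filterlim)
    \<comment> \<open>The bounds \<open>ln E\<close> and \<open>0\<close> fix the signs of the
      logarithms; the last one lets the gap between \<open>s\<close> and \<open>t\<close> absorb the
      shift by \<open>ln E\<close>.\<close>
    moreover have "\<forall>\<^sub>F n in sequentially. max (max (ln E) 0) (t * ln E / (t - s)) < - ln (R n)"
      using ln_R by (simp only: filterlim_at_top_dense)
    ultimately have "\<forall>\<^sub>F n in sequentially.
        ereal t < ereal (ln (real (covering_number (R n * E) K)) / - ln (R n * E)) \<and>
        max (max (ln E) 0) (t * ln E / (t - s)) < - ln (R n) \<and> 1 \<le> n"
      by (intro eventually_conj eventually_ge_at_top)
    moreover have "\<exists>\<^sub>F n in sequentially. moran_exponent N r n < s"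
      using s s0 by (intro frequently_moran_exponent_less) simp
    ultimately obtain n where n: "moran_exponent N r n < s" "1 \<le> n"
        "t < ln (real (covering_number (R n * E) K)) / - ln (R n * E)"
        "ln E < - ln (R n)" "0 < - ln (R n)" "t * ln E / (t - s) < - ln (R n)"
      using frequently_ex[OF frequently_eventually_conj] by fastforce
    let ?m = "covering_number (R n * E) K"
    have "?m \<le> card ((\<lambda>v. word_map v n ` X) ` words n)"
      using K_subset_cylinders[of n] finite_words cylinder_diameter ratio
      by (intro covering_number_le) auto
    also have "\<dots> \<le> card (words n)" by (rule card_image_le[OF finite_words])
    finally have "real ?m * R n powr s \<le> real (card (words n)) * R n powr s"
      by (intro mult_right_mono) auto
    also have "\<dots> = P n s" unfolding sum_ratio_powr[symmetric] by (simp add: ratio)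
    also have "\<dots> \<le> 1" using moran_prod_le_1_iff[OF n(2)] n(1) by simp
    finally have m: "real ?m * R n powr s \<le> 1" .
    have "ln (real ?m) \<le> s * - ln (R n)"
    \<comment> \<open>The default value \<open>ln 0 = 0\<close> makes the degenerate case
      true.\<close>
    proof (cases "?m = 0")
      case True
      then show ?thesis using s0 s n by (simp add: mult_nonneg_nonpos)
    next
      case False
      then have "ln (real ?m * R n powr s) = ln (real ?m) + s * ln (R n)"
        using R_pos[of n] by (simp add: ln_mult ln_powr)
      moreover have "ln (real ?m * R n powr s) \<le> 0"
        using m False R_pos[of n] by simp
      ultimately show ?thesis by simp
    qed
    moreover have ln_RE: "- ln (R n * E) = - ln (R n) - ln E"
      using R_pos[of n] E_pos by (simp add: ln_mult)
    then have "t * (- ln (R n) - ln E) < ln (real ?m)"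
      using n(3,4) by (simp add: pos_less_divide_eq)
    moreover have "t * ln E < - ln (R n) * (t - s)"
      using n(6) s by (simp add: pos_divide_less_eq)
    ultimately show False by (simp add: algebra_simps)
  qed
  then show ?thesis unfolding hausdorff_dim_K s0(2) by (rule dense_ge)
qed

end

section \<open>The three assertions, from the two-sided bounds on the measure\<close>

theorem corollary4p3:
  fixes X :: "(real^'d) set"
    and N :: "nat \<Rightarrow> nat"
    and r :: "nat \<Rightarrow> nat \<Rightarrow> real"
    and Q :: "nat \<Rightarrow> nat \<Rightarrow> real^'d^'d"
    and \<alpha> :: "nat \<Rightarrow> nat \<Rightarrow> real^'d"
    and a :: "real^'d"
  assumes "self_similar_MIFS X N r Q \<alpha>"
    and "MOSC X N (similarity_map r Q \<alpha>)"
    and "0 < Inf {r n j | n j. 1 \<le> n \<and> 1 \<le> j \<and> j \<le> N n}"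
    and "a \<in> X"
  shows "let K = attractor N (similarity_map r Q \<alpha>) a;
             s = real_of_ereal (hausdorff_dim (K 1));
             L = liminf (\<lambda>n. ereal (moran_prod N r n s))
         in hausdorff_dim (K 1) = liminf (\<lambda>k. ereal (moran_exponent N r k)) \<and>
            (L = \<infinity> \<longrightarrow> hausdorff_measure s (K 1) = \<infinity>) \<and>
            (L = 0 \<longrightarrow> hausdorff_measure s (K 1) = 0) \<and>
            (0 < L \<and> L < \<infinity> \<longrightarrow>
               0 < hausdorff_measure s (K 1) \<and> hausdorff_measure s (K 1) < \<infinity>) \<and>
            ((\<exists>\<rho> :: nat \<Rightarrow> real. \<forall>n\<ge>1. \<forall>j\<in>{1..N n}. r n j = \<rho> n) \<longrightarrow>
               hausdorff_dim (K 1) = lower_box_dim (K 1))"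
proof -
  note mifs = assms(1)[unfolded self_similar_MIFS_def]
  have X: "compact X" using mifs by blast
  have maps: "2 \<le> N n" "\<And>j. j \<in> {1..N n} \<Longrightarrow> 0 < r n j \<and> orthogonal_matrix (Q n j) \<and>
      similarity_map r Q \<alpha> n j ` X \<subseteq> X" if "1 \<le> n" for n
    using mifs that by auto
  obtain c1 c2 :: "nat \<Rightarrow> real" where c: "\<And>n. 1 \<le> n \<Longrightarrow> c2 n < 1"
      "\<And>n j. 1 \<le> n \<Longrightarrow> j \<in> {1..N n} \<Longrightarrow> r n j \<le> c2 n" "(\<lambda>n. \<Prod>j=1..n. c2 j) \<longlonglongrightarrow> 0"
    using mifs by blast
  obtain V where V: "\<And>n. 1 \<le> n \<Longrightarrow> open (V n) \<and> V n \<subseteq> X \<and>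
        (\<forall>j\<in>{1..N n}. similarity_map r Q \<alpha> n j ` V (Suc n) \<subseteq> V n) \<and>
        (\<forall>i\<in>{1..N n}. \<forall>j\<in>{1..N n}. i \<noteq> j \<longrightarrow>
          similarity_map r Q \<alpha> n i ` V (Suc n) \<inter> similarity_map r Q \<alpha> n j ` V (Suc n) = {})"
      and V0: "0 < (INF n\<in>{1..}. emeasure lborel (V n))"
    using assms(2) unfolding MOSC_def by blast
  define v0 where "v0 = enn2real (INF n\<in>{1..}. emeasure lborel (V n))"
  define r0 where "r0 = Inf {r n j | n j. 1 \<le> n \<and> 1 \<le> j \<and> j \<le> N n}"
  have V_fin: "emeasure lborel (V n) < \<infinity>" if "1 \<le> n" for n
    using V[OF that] bounded_subset[OF compact_imp_bounded[OF X]]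
    by (metis emeasure_bounded_finite)
  have INF_le: "(INF n\<in>{1..}. emeasure lborel (V n)) \<le> emeasure lborel (V n)" if "1 \<le> n" for n
    using that by (intro INF_lower) auto
  interpret moran_ifs X N r Q \<alpha> a c2 V v0 r0
  proof
    \<comment> \<open>The infimum is positive by MOSC and finite because \<open>V 1\<close> lies in
      the bounded set \<open>X\<close>; \<open>enn2real\<close> needs both.\<close>
    show "0 < v0"
      using V0 le_less_trans[OF INF_le V_fin, of 1] by (simp add: v0_def enn2real_positive_iff)
    show "v0 \<le> measure lebesgue (V n)" if "1 \<le> n" for n
    proof -
      have "V n \<in> sets lborel" using V[OF that] by (simp add: borel_open)
      then have "emeasure lebesgue (V n) = emeasure lborel (V n)" by simp
      with INF_le[OF that] V_fin[OF that] show ?thesis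
        unfolding v0_def measure_def by (simp add: enn2real_mono)
    qed
    show "r0 \<le> r n j" if "1 \<le> n" "j \<in> {1..N n}" for n j
      unfolding r0_def
    proof (rule cInf_lower)
      show "bdd_below {r n j | n j. 1 \<le> n \<and> 1 \<le> j \<and> j \<le> N n}"
        using maps(2) by (intro bdd_belowI[of _ 0]) (auto intro!: less_imp_le)
    qed (use that in auto)
    show "0 < r0" using assms(3) by (simp add: r0_def)
    show "open (V n)" "V n \<subseteq> X" if "1 \<le> n" for n
      using V[OF that] by simp_all
    show "similarity_map r Q \<alpha> n j ` V (Suc n) \<subseteq> V n" if "1 \<le> n" "j \<in> {1..N n}" for n j
      using V[OF that(1)] that(2) by (elim conjE) (erule bspec)
    show "similarity_map r Q \<alpha> n i ` V (Suc n) \<inter> similarity_map r Q \<alpha> n j ` V (Suc n) = {}"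
      if "1 \<le> n" "i \<in> {1..N n}" "j \<in> {1..N n}" "i \<noteq> j" for n i j
    proof -
      have "\<forall>i\<in>{1..N n}. \<forall>j\<in>{1..N n}. i \<noteq> j \<longrightarrow>
          similarity_map r Q \<alpha> n i ` V (Suc n) \<inter> similarity_map r Q \<alpha> n j ` V (Suc n) = {}"
        using V[OF that(1)] by (elim conjE)
      with that(2,3,4) show ?thesis by blast
    qed
    show "orthogonal_matrix (Q n j)" "similarity_map r Q \<alpha> n j ` X \<subseteq> X"
      if "1 \<le> n" "j \<in> {1..N n}" for n j
      using maps(2)[OF that] by simp_all
  qed (fact X assms(4) c maps(1))+
  obtain s where s: "0 < s" "liminf (\<lambda>n. ereal (moran_exponent N r n)) = ereal s"
    by (rule moran_liminf_real)
  let ?L = "liminf (\<lambda>n. ereal (P n s))"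
  have ge: "ennreal (b / overlap_bound) \<le> hausdorff_measure s K" if "0 < b" "ereal b < ?L" for b
    using less_LiminfD[OF that(2)]
    by (intro hausdorff_measure_K_ge s that) (auto elim: eventually_mono)
  have frequently: "\<exists>\<^sub>F n in sequentially. P n s \<le> b" if "?L < ereal b" for b
  proof (rule ccontr)
    assume "\<not> ?thesis"
    then have "ereal b \<le> ?L"
      by (intro Liminf_bounded) (auto simp: frequently_def elim: eventually_mono)
    with that show False by simp
  qed
  have "hausdorff_measure s K = \<infinity>" if "?L = \<infinity>"
  proof (rule ccontr)
    assume fin: "hausdorff_measure s K \<noteq> \<infinity>"
    define m where "m = enn2real (hausdorff_measure s K)"
    \<comment> \<open>With \<open>b = (m + 1) * overlap_bound\<close> the lower bound is
      \<open>m + 1\<close>, exceeding the supposed value \<open>m\<close>.\<close>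
    have "ennreal ((m + 1) * overlap_bound / overlap_bound) \<le> hausdorff_measure s K"
      using that overlap_bound_pos by (intro ge) (auto simp: m_def intro!: mult_pos_pos add_nonneg_pos)
    also have "\<dots> = ennreal m" using fin by (simp add: m_def top.not_eq_extremum)
    finally show False using overlap_bound_pos by (simp add: m_def)
  qed
  moreover have "hausdorff_measure s K = 0" if "?L = 0"
    using s frequently that by (intro hausdorff_measure_K_eq_0) auto
  moreover have "0 < hausdorff_measure s K" if L: "0 < ?L"
  proof -
    obtain b where b: "0 < ereal b" "ereal b < ?L" using ereal_dense2[OF L] by blast
    then have "0 < ennreal (b / overlap_bound)" using overlap_bound_pos by simp
    also have "\<dots> \<le> hausdorff_measure s K" using b by (intro ge) auto
    finally show ?thesis .
  qed
  moreover have "hausdorff_measure s K < \<infinity>" if L: "?L < \<infinity>"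
  proof -
    obtain b where "?L < ereal b" using ereal_dense2[OF L] by blast
    from hausdorff_measure_K_le[OF s(1) frequently[OF this]] show ?thesis
      by (rule le_less_trans) simp
  qed
  moreover have "hausdorff_dim K = lower_box_dim K"
    if "\<exists>\<rho>. \<forall>n\<ge>1. \<forall>j\<in>{1..N n}. r n j = \<rho> n"
    using that hausdorff_dim_K_le_lower_box_dim lower_box_dim_le_hausdorff_dim_K
    by (metis antisym)
  ultimately show ?thesis
    using s(2) by (simp add: Let_def K_def[symmetric] hausdorff_dim_K del: One_nat_def)
qed

end
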